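(* Let $d\in\mathbb{N}$, $d\ge 1$, let $f\in C^{\infty}([0,1])$ be real-valued, and let $b\in\mathbb{Q}$ with $b>1$. Let $\mathbb{N}_b=\{n\in\mathbb{N}: nb\in\mathbb{N} \text{ and } 2\mid nb\}$. For $n\in\mathbb{N}_b$ with $n\ge d-1$, let $\tau_n(f)$ be the modified FC-Gram trigonometric polynomial approximation of $f$ with parameters $d$ and $b$ (defined in the context), which interpolates $f$ at the points $x_j=j/n$, $0\le j\le n$. Then there exists $M>0$, independent of $n$, such that $$\Vert \tau_n(f)-f\Vert_{\infty,[0,1]}\le M\,n^{-d}$$ for all $n\in\mathbb{N}_b$ with $n\ge d-1$.
   Context: Here $\Vert g\Vert_{\infty,[0,1]}=\sup_{x\in[0,1]}|g(x)|$. Fix $d\ge1$ and $b\in\mathbb{Q}$, $b>1$. For $n\in\mathbb{N}_b$ with $n\ge d-1$ set $h=1/n$ and $x_j=jh$. (With $C=nb-n-1$ one has $b=1+(C+1)h$, and $nb=n+C+1$ is even.) **Gram polynomials.** Define the discrete bilinear forms $$\langle p,q\rangle_L=\sum_{j=0}^{d-1}p(x_j)q(x_j),\qquad \langle p,q\rangle_R=\sum_{j=0}^{d-1}p(x_{n-j})q(x_{n-j}).$$ The left Gram polynomials $p_0^L,\dots,p_{d-1}^L$ are the polynomials obtained by Gram–Schmidt orthonormalization of $1,x,\dots,x^{d-1}$ with respect to $\langle\cdot,\cdot\rangle_L$; thus $p_\ell^L$ has degree $\ell$ and positive leading coefficient, and $\langle p_k^L,p_\ell^L\rangle_L=\delta_{k\ell}$.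 The right Gram polynomials are $p_\ell^R(x)=p_\ell^L(x-1+(d-1)h)$; they satisfy $\langle p_k^R,p_\ell^R\rangle_R=\delta_{k\ell}$. **Two-point Hermite polynomials.** Let $r=d-1$. For real $u_1\neq u_2$ and $0\le m\le r$, $$p_m^{u_1,u_2}(u)=\frac{1}{m!}(u-u_1)^m\left(\frac{u-u_2}{u_1-u_2}\right)^{r+1}\sum_{\ell=0}^{r-m}\binom{r+\ell}{r}\left(\frac{u-u_1}{u_2-u_1}\right)^{\ell}.$$ **Extension.** For $0\le\ell\le d-1$ put $$p_\ell^{R,e}(x)=\sum_{m=0}^{\ell}(p_\ell^R)^{(m)}(1)\,p_m^{1,b}(x),\qquad p_\ell^{L,e}(x)=\sum_{m=0}^{\ell}(p_\ell^L)^{(m)}(0)\,p_m^{b,1}(x),$$ and define the extension $p$ of $f$ to $[1,b]$ by $$p(x)=\sum_{\ell=0}^{d-1}\langle f,p_\ell^L\rangle_L\,p_\ell^{L,e}(x)+\sum_{\ell=0}^{d-1}\langle f,p_\ell^R\rangle_R\,p_\ell^{R,e}(x).$$ **Approximation.** Set $f_j^c=f(x_j)$ for $0\le j\le n$ and $f_j^c=p(x_j)$ for $n+1\le j\le nb-1$. Then, for $x\in[0,b)$, $$\tau_n(f)(x)=\sum_{j=0}^{nb-1}f_j^c\,L_j(x),$$ where $L_j(x_j)=1$ and, for $x\in[0,b)$ with $x\ne x_j$, $$L_j(x)=\frac{1}{nb}\left(\sin\!\left(\frac{\pi(nb-1)(j-nx)}{nb}\right)\csc\!\left(\frac{\pi(j-nx)}{nb}\right)+\cos(\pi(j-nx))\right).$$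 *)

theory Defs
  imports "HOL-Analysis.Analysis" "HOL-Computational_Algebra.Polynomial"
begin

text \<open>
  \<open>C\<^sup>\<infinity>(S)\<close> for real-valued functions; \<open>D k\<close> is the \<open>k\<close>-th derivative, and derivatives are taken
  within \<open>S\<close>, hence one-sided at the endpoints of an interval.
\<close>
definition smooth_on :: "real set \<Rightarrow> (real \<Rightarrow> real) \<Rightarrow> bool" where
  "smooth_on S f \<longleftrightarrow>
     (\<exists>D :: nat \<Rightarrow> real \<Rightarrow> real. (\<forall>x\<in>S. D 0 x = f x) \<and>
        (\<forall>k. \<forall>x\<in>S. (D k has_real_derivative D (Suc k) x) (at x within S)))"

text \<open>The supremum is taken in the extended reals, so that an unbounded \<open>g\<close> has norm \<open>\<infinity>\<close>.\<close>
definition sup_norm_on :: "real set \<Rightarrow> (real \<Rightarrow> real) \<Rightarrow> ereal" where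
  "sup_norm_on S g = (SUP x\<in>S. ereal \<bar>g x\<bar>)"

text \<open>\<open>n = 0\<close> is excluded since the mesh width is \<open>1/n\<close>.\<close>
definition Nb :: "real \<Rightarrow> nat set" where
  "Nb b = {n. n > 0 \<and> (\<exists>m::nat. real n * b = real m \<and> 2 dvd m)}"

definition grid_pt :: "nat \<Rightarrow> nat \<Rightarrow> real" where
  "grid_pt n j = real j / real n"

text \<open>The natural number \<open>nb\<close>; exact whenever \<open>n \<in> Nb b\<close>.\<close>
definition period_pts :: "real \<Rightarrow> nat \<Rightarrow> nat" where
  "period_pts b n = nat \<lfloor>real n * b\<rfloor>"

definition ip_left :: "nat \<Rightarrow> nat \<Rightarrow> (real \<Rightarrow> real) \<Rightarrow> (real \<Rightarrow> real) \<Rightarrow> real" where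
  "ip_left d n p q = (\<Sum>j<d. p (grid_pt n j) * q (grid_pt n j))"

definition ip_right :: "nat \<Rightarrow> nat \<Rightarrow> (real \<Rightarrow> real) \<Rightarrow> (real \<Rightarrow> real) \<Rightarrow> real" where
  "ip_right d n p q = (\<Sum>j<d. p (grid_pt n (n - j)) * q (grid_pt n (n - j)))"

text \<open>Gram--Schmidt orthonormalization of \<open>1, x, \<dots>, x\<^bsup>d-1\<^esup>\<close>; meaningful for indices \<open>l < d\<close>.\<close>
fun gram_left :: "nat \<Rightarrow> nat \<Rightarrow> nat \<Rightarrow> real poly" where
  "gram_left d n l =
     (let q = monom 1 l -
                (\<Sum>k<l. smult (ip_left d n (poly (monom 1 l)) (poly (gram_left d n k))) (gram_left d n k))
      in smult (1 / sqrt (ip_left d n (poly q) (poly q))) q)"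

declare gram_left.simps [simp del]

definition gram_right :: "nat \<Rightarrow> nat \<Rightarrow> nat \<Rightarrow> real poly" where
  "gram_right d n l = pcompose (gram_left d n l) [: - 1 + (real d - 1) / real n, 1 :]"

definition hermite2 :: "nat \<Rightarrow> nat \<Rightarrow> real \<Rightarrow> real \<Rightarrow> real \<Rightarrow> real" where
  "hermite2 r m u1 u2 u =
     1 / fact m * (u - u1) ^ m * ((u - u2) / (u1 - u2)) ^ (r + 1) *
     (\<Sum>l=0..r - m. real ((r + l) choose r) * ((u - u1) / (u2 - u1)) ^ l)"

definition gram_right_ext :: "nat \<Rightarrow> real \<Rightarrow> nat \<Rightarrow> nat \<Rightarrow> real \<Rightarrow> real" where
  "gram_right_ext d b n l x =
     (\<Sum>m=0..l. poly ((pderiv ^^ m) (gram_right d n l)) 1 * hermite2 (d - 1) m 1 b x)"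

definition gram_left_ext :: "nat \<Rightarrow> real \<Rightarrow> nat \<Rightarrow> nat \<Rightarrow> real \<Rightarrow> real" where
  "gram_left_ext d b n l x =
     (\<Sum>m=0..l. poly ((pderiv ^^ m) (gram_left d n l)) 0 * hermite2 (d - 1) m b 1 x)"

definition gram_extension :: "nat \<Rightarrow> real \<Rightarrow> nat \<Rightarrow> (real \<Rightarrow> real) \<Rightarrow> real \<Rightarrow> real" where
  "gram_extension d b n f x =
     (\<Sum>l<d. ip_left d n f (poly (gram_left d n l)) * gram_left_ext d b n l x) +
     (\<Sum>l<d. ip_right d n f (poly (gram_right d n l)) * gram_right_ext d b n l x)"

definition continued_value :: "nat \<Rightarrow> real \<Rightarrow> nat \<Rightarrow> (real \<Rightarrow> real) \<Rightarrow> nat \<Rightarrow> real" where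
  "continued_value d b n f j =
     (if j \<le> n then f (grid_pt n j) else gram_extension d b n f (grid_pt n j))"

text \<open>
  The formula is intended on \<open>[0,b)\<close>; there the sine in the denominator (the cosecant) vanishes only
  at \<open>x = x\<^sub>j\<close>.
\<close>
definition cardinal_fun :: "real \<Rightarrow> nat \<Rightarrow> nat \<Rightarrow> real \<Rightarrow> real" where
  "cardinal_fun b n j x =
     (if x = grid_pt n j then 1
      else 1 / (real n * b) *
        (sin (pi * (real n * b - 1) * (real j - real n * x) / (real n * b)) *
           (1 / sin (pi * (real j - real n * x) / (real n * b))) +
         cos (pi * (real j - real n * x))))"

definition fc_gram :: "nat \<Rightarrow> real \<Rightarrow> nat \<Rightarrow> (real \<Rightarrow> real) \<Rightarrow> real \<Rightarrow> real" where
  "fc_gram d b n f x =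
     (\<Sum>j<period_pts b n. continued_value d b n f j * cardinal_fun b n j x)"

end

theory Submission
  imports Defs
begin

text \<open>
  Glue \<open>f\<close> on \<open>[0,1]\<close> and the extension \<open>p\<close> on \<open>[1,b]\<close> to a \<open>b\<close>-periodic function \<open>F\<close>. The Gram
  projections are the interpolants of \<open>f\<close> at the first and last \<open>d\<close> grid points, and the Hermite
  polynomials transfer their derivatives of order below \<open>d\<close> to the ends of \<open>[1,b]\<close>; by Rolle's theorem
  the \<open>m\<close>-th derivative of \<open>F\<close> therefore jumps by \<open>O(n\<^bsup>m-d\<^esup>)\<close> only. Since \<open>0\<close> and \<open>1\<close> are grid points,
  \<open>F\<close> itself is continuous, so integrating by parts \<open>d + 1\<close> times bounds the \<open>k\<close>-th Fourier coefficient
  of \<open>F\<close> by a multiple of \<open>n\<^bsup>1-d\<^esup> / k\<^sup>2\<close> for \<open>\<bar>k\<bar> \<ge> nb/2\<close>. Trigonometric interpolation is exact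
  on frequencies below \<open>nb/2\<close> and aliases all others to functions of modulus at most \<open>1\<close>, so its error
  is at most twice the sum of those coefficients, which is \<open>O(n\<^bsup>-d\<^esup>)\<close>. The vanishing jump of order
  \<open>0\<close> is what avoids a logarithm.
\<close>

section \<open>Absolutely convergent Fourier series\<close>

text \<open>The glued function F changes with n, so every constant has to be uniform in n. Two facts
  secure this. The Hermite polynomials do not involve n. The d nodes at either end span an interval
  of length \<open>(d - 1) / n \<le> 1\<close> inside [0,1], so the derivatives of the interpolants
  at 0 and 1 stay below twice a bound for those of f. Hence the derivatives of order d and d + 1 of
  the extension are bounded on [1,b] independently of n.

  The inversion formula must hold pointwise, at x and at every grid point alike. Mean-square
  convergence would not be enough, so the formula is derived from absolute convergence and the
  uniqueness of Fourier coefficients.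

  The cosine term in the cardinal function is absorbed by writing that function as the mean of two
  sums over nb consecutive frequencies, one window starting at -nb/2, the other ending at nb/2. Each
  window is a complete residue system modulo nb, so every frequency has exactly one alias in it, the
  borderline frequency nb/2 included.\<close>

definition fexp :: "real \<Rightarrow> int \<Rightarrow> real \<Rightarrow> complex" where
  "fexp b k y = cis (2 * pi * of_int k * y / b)"

lemma norm_fexp [simp]: "norm (fexp b k y) = 1"
  by (simp add: fexp_def)

lemma fexp_0 [simp]: "fexp b 0 y = 1"
  by (simp add: fexp_def)

lemma fexp_at_0 [simp]: "fexp b k 0 = 1"
  by (simp add: fexp_def)

lemma fexp_add: "fexp b (k + l) y = fexp b k y * fexp b l y"
  by (simp add: fexp_def cis_mult ring_distribs add_divide_distrib)

lemma fexp_period: "b \<noteq> 0 \<Longrightarrow> fexp b k b = 1"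
  using cis_multiple_2pi[of "of_int k"] by (simp add: fexp_def mult_ac)

lemma cnj_fexp: "cnj (fexp b k y) = fexp b (- k) y"
  by (simp add: fexp_def cis_cnj)

lemma continuous_on_fexp [continuous_intros]:
  "continuous_on S (fexp b k)"
  unfolding fexp_def[abs_def] by (cases "b = 0") (auto intro!: continuous_intros)

lemma has_vector_derivative_fexp:
  "(fexp b k has_vector_derivative (\<i> * of_real (2 * pi * of_int k / b) * fexp b k y)) (at y within S)"
proof -
  define w where "w = \<i> * complex_of_real (2 * pi * of_int k / b)"
  have "((\<lambda>y. exp (w * of_real y)) has_vector_derivative (w * exp (w * of_real y))) (at y within S)"
    by (rule has_vector_derivative_real_field) (auto intro!: derivative_eq_intros)
  moreover have "fexp b k = (\<lambda>y. exp (w * of_real y))"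
    by (rule ext) (simp add: fexp_def cis_conv_exp w_def mult.assoc)
  ultimately show ?thesis by (simp add: w_def)
qed

lemma integral_fexp:
  assumes "b > 0"
  shows "(fexp b k has_integral (if k = 0 then of_real b else 0)) {0..b}"
proof (cases "k = 0")
  case True
  then show ?thesis
    using has_integral_const_real[of "1::complex" 0 b] assms
    by (simp add: fexp_def[abs_def] scaleR_conv_of_real)
next
  case False
  define w where "w = \<i> * complex_of_real (2 * pi * of_int k / b)"
  have w: "w \<noteq> 0" using False assms by (simp add: w_def)
  have "((\<lambda>y. w * fexp b k y) has_integral (fexp b k b - fexp b k 0)) {0..b}"
    using assms unfolding w_def
    by (intro fundamental_theorem_of_calculus has_vector_derivative_fexp) auto
  then have "((\<lambda>y. inverse w * (w * fexp b k y)) has_integral 0) {0..b}"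
    using assms by (auto dest: has_integral_mult_right[where c="inverse w"] simp: fexp_period)
  then show ?thesis using w False by (simp add: field_simps)
qed

section \<open>Uniqueness of Fourier coefficients and pointwise inversion\<close>

definition fourier_coeff :: "real \<Rightarrow> (real \<Rightarrow> complex) \<Rightarrow> int \<Rightarrow> complex" where
  "fourier_coeff b F k = integral {0..b} (\<lambda>y. F y * fexp b (- k) y) / of_real b"

lemma continuous_on_real_polynomial_fexp:
  fixes q :: "complex \<Rightarrow> real"
  assumes "real_polynomial_function q"
  shows "continuous_on S (\<lambda>y. q (fexp b k y))"
proof -
  have "continuous_on UNIV q"
    using assms continuous_polymonial_function continuous_at_imp_continuous_on
    by (metis real_polynomial_function_eq)
  then show ?thesis
    by (rule continuous_on_compose2) (auto intro!: continuous_intros)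
qed

text \<open>Quantifying over \<open>H\<close> inside the induction makes the product case immediate.\<close>
lemma fourier_coeffs_zero_mult:
  fixes q :: "complex \<Rightarrow> real"
  assumes "real_polynomial_function q"
    and "continuous_on {0..b} H" "\<And>k. fourier_coeff b H k = 0" "b > 0"
  shows "fourier_coeff b (\<lambda>y. H y * of_real (q (fexp b 1 y))) k = 0"
  using assms
proof (induction q arbitrary: H k rule: real_polynomial_function.induct)
  case (linear q)
  interpret q: bounded_linear q by fact
  \<comment> \<open>A real-linear functional on the complex plane has the form
    \<open>\<alpha> * z + \<beta> * cnj z\<close>. On the unit circle the two terms shift the
    frequency by +1 and -1, so vanishing of all coefficients is preserved.\<close>
  define \<alpha> where "\<alpha> = (of_real (q 1) - \<i> * of_real (q \<i>)) / 2"
  define \<beta> where "\<beta> = (of_real (q 1) + \<i> * of_real (q \<i>)) / 2"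
  have q: "of_real (q z) = \<alpha> * z + \<beta> * cnj z" for z
  proof -
    have "z = Re z *\<^sub>R 1 + Im z *\<^sub>R \<i>" by (simp add: complex_eq_iff)
    then have "q z = Re z * q 1 + Im z * q \<i>"
      by (metis q.add q.scaleR real_scaleR_def)
    then show ?thesis by (simp add: \<alpha>_def \<beta>_def complex_eq_iff field_simps)
  qed
  have cont: "continuous_on {0..b} (\<lambda>y. H y * fexp b l y)" for l
    using linear.prems by (intro continuous_intros)
  have I: "((\<lambda>y. H y * fexp b l y) has_integral 0) {0..b}" for l
  proof -
    have "integral {0..b} (\<lambda>y. H y * fexp b l y) = 0"
      using linear.prems(2)[of "- l"] linear.prems(3) by (simp add: fourier_coeff_def)
    then show ?thesis
      using integrable_continuous_real[OF cont[of l]] by (metis integrable_integral)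
  qed
  have "((\<lambda>y. \<alpha> * (H y * fexp b (1 - k) y) + \<beta> * (H y * fexp b (- 1 - k) y)) has_integral
      \<alpha> * 0 + \<beta> * 0) {0..b}"
    by (intro has_integral_add has_integral_mult_right I)
  moreover have "\<alpha> * (H y * fexp b (1 - k) y) + \<beta> * (H y * fexp b (- 1 - k) y) =
      H y * of_real (q (fexp b 1 y)) * fexp b (- k) y" for y
    using fexp_add[of b 1 "- k" y] fexp_add[of b "- 1" "- k" y]
    by (simp add: q cnj_fexp algebra_simps)
  ultimately have "integral {0..b} (\<lambda>y. H y * of_real (q (fexp b 1 y)) * fexp b (- k) y) = 0"
    by (simp add: integral_unique)
  then show ?case
    by (simp add: fourier_coeff_def)
next
  case (const c)
  have "fourier_coeff b (\<lambda>y. H y * of_real c) k = fourier_coeff b H k * of_real c"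
    by (simp add: fourier_coeff_def mult.assoc mult.commute[of "of_real c"] flip: integral_mult_left)
  then show ?case using const by simp
next
  case (add p q)
  have cont: "continuous_on {0..b} (\<lambda>y. H y * of_real (g (fexp b 1 y)) * fexp b (- k) y)"
    if "real_polynomial_function g" for g
    using add.prems that by (intro continuous_intros continuous_on_real_polynomial_fexp)
  have "fourier_coeff b (\<lambda>y. H y * of_real (p (fexp b 1 y) + q (fexp b 1 y))) k =
     fourier_coeff b (\<lambda>y. H y * of_real (p (fexp b 1 y))) k +
       fourier_coeff b (\<lambda>y. H y * of_real (q (fexp b 1 y))) k"
    unfolding fourier_coeff_def add_divide_distrib[symmetric]
    by (subst integral_add[symmetric])
       (auto simp: ring_distribs intro!: integrable_continuous_real cont add.hyps)
  then show ?case using add by simp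
next
  case (mult p q)
  have "continuous_on {0..b} (\<lambda>y. H y * of_real (p (fexp b 1 y)))"
    using mult.prems mult.hyps by (intro continuous_intros continuous_on_real_polynomial_fexp)
  from mult.IH(2)[OF this mult.IH(1)[OF mult.prems] mult.prems(3)]
  show ?case by (simp add: mult.assoc)
qed

text \<open>Moves a periodic function to a compact subset of the plane, where polynomials are
  available for approximation. The winding map identifies only 0 with b, so \<open>G 0 = G b\<close>
  makes the choice of preimage immaterial. It is a continuous surjection from a compact space, hence
  carries the compact preimages of closed sets to closed sets, and this is continuity of g.\<close>

lemma continuous_periodic_factors_through_circle:
  fixes G :: "real \<Rightarrow> complex"
  assumes "b > 0" "continuous_on {0..b} G" "G 0 = G b"
  obtains g where "continuous_on (sphere 0 1) g" "\<And>y. y \<in> {0..b} \<Longrightarrow> g (fexp b 1 y) = G y"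
proof -
  have inj: "G y = G z" if "y \<in> {0..b}" "z \<in> {0..b}" "fexp b 1 y = fexp b 1 z" for y z
  proof -
    from that(3) have "cis (2 * pi * (y / b)) = cis (2 * pi * (z / b))"
      by (simp add: fexp_def)
    then have "exp (\<i> * of_real (2 * pi * (y / b))) = exp (\<i> * of_real (2 * pi * (z / b)))"
      by (simp add: cis_conv_exp)
    then obtain m :: int where m: "\<i> * of_real (2 * pi * (y / b)) =
      \<i> * of_real (2 * pi * (z / b)) + of_real (2 * m * pi) * \<i>"
      by (auto simp: exp_eq)
    then have "2 * pi * (y / b) = 2 * pi * (z / b) + 2 * m * pi"
      by (simp add: complex_eq_iff)
    then have "2 * pi * (y / b) = 2 * pi * (z / b + m)" by (simp add: algebra_simps)
    then have "y / b = z / b + m" by (metis mult_cancel_left pi_neq_zero mult_eq_0_iff zero_neq_numeral)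
    then have yz: "y = z + m * b" using assms by (simp add: field_simps)
    \<comment> \<open>Two points of [0,b] differ by at most one period. If m is 1 or -1, they are
      the two endpoints.\<close>
    then have "\<bar>m * b\<bar> \<le> b" using that by auto
    then have "\<bar>m\<bar> \<le> 1" using assms by (simp add: abs_mult flip: of_int_abs)
    then consider "m = 0" | "m = 1" | "m = -1" by linarith
    then show ?thesis
      using yz that assms by cases (auto simp: algebra_simps)
  qed
  have surj: "fexp b 1 ` {0..b} = sphere 0 1"
  proof (intro equalityI subsetI)
    fix z :: complex assume "z \<in> sphere 0 1"
    then have z: "z = cis (Arg2pi z)" using Arg2pi_eq[of z] by (simp add: cis_conv_exp)
    have "Arg2pi z * b / (2 * pi) \<in> {0..b}"
      using Arg2pi_ge_0[of z] Arg2pi_lt_2pi[of z] assms by (auto simp: field_simps)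
    moreover have "fexp b 1 (Arg2pi z * b / (2 * pi)) = z"
      using assms z by (simp add: fexp_def)
    ultimately show "z \<in> fexp b 1 ` {0..b}" by (metis image_eqI)
  qed auto
  define g where "g z = G (SOME y. y \<in> {0..b} \<and> fexp b 1 y = z)" for z
  have g: "g (fexp b 1 y) = G y" if "y \<in> {0..b}" for y
  proof -
    have "(SOME z. z \<in> {0..b} \<and> fexp b 1 z = fexp b 1 y) \<in> {0..b} \<and>
       fexp b 1 (SOME z. z \<in> {0..b} \<and> fexp b 1 z = fexp b 1 y) = fexp b 1 y"
      by (rule someI) (use that in auto)
    then show ?thesis unfolding g_def using inj that by blast
  qed
  have "continuous_on (sphere 0 1) g"
    unfolding continuous_on_closed_vimage[OF closed_sphere]
  proof -
    show "\<forall>B. closed B \<longrightarrow> closed (g -` B \<inter> sphere 0 1)"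
    proof (intro allI impI)
      fix B :: "complex set" assume B: "closed B"
      have "g -` B \<inter> sphere 0 1 = fexp b 1 ` (G -` B \<inter> {0..b})"
        unfolding surj[symmetric] using g by auto
      moreover have "compact (G -` B \<inter> {0..b})"
      proof -
        have "closed (G -` B \<inter> {0..b})"
          using assms(2) B by (simp add: continuous_on_closed_vimage)
        moreover have "G -` B \<inter> {0..b} = {0..b} \<inter> (G -` B \<inter> {0..b})" by blast
        ultimately show ?thesis by (metis compact_Int_closed compact_Icc)
      qed
      ultimately show "closed (g -` B \<inter> sphere 0 1)"
        by (simp add: compact_continuous_image compact_imp_closed continuous_on_fexp)
    qed
  qed
  then show ?thesis using g by (intro that) auto
qed

text \<open>G is orthogonal to every polynomial in the real and imaginary parts of
  \<open>fexp b 1\<close>. With p uniformly within \<epsilon> of the conjugate of G, the integral J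
  of the squared modulus of G equals that of \<open>G * (cnj G - p)\<close>, which is at most
  \<epsilon> B b.\<close>

lemma fourier_coeffs_zero_imp_zero:
  fixes G :: "real \<Rightarrow> complex"
  assumes "b > 0" "continuous_on {0..b} G" "G 0 = G b" "\<And>k. fourier_coeff b G k = 0" "y \<in> {0..b}"
  shows "G y = 0"
proof -
  obtain g where g: "continuous_on (sphere 0 1) g" "\<And>y. y \<in> {0..b} \<Longrightarrow> g (fexp b 1 y) = cnj (G y)"
    using continuous_periodic_factors_through_circle[of b "\<lambda>y. cnj (G y)"] assms
    by (metis continuous_on_cnj)
  have "bounded (G ` {0..b})"
    using assms by (intro compact_imp_bounded compact_continuous_image) auto
  then obtain B where B: "B > 0" "\<And>y. y \<in> {0..b} \<Longrightarrow> norm (G y) \<le> B"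
    by (auto simp: bounded_pos)
  have *: "((\<lambda>y. G y * of_real (q (fexp b 1 y))) has_integral 0) {0..b}"
      if q: "real_polynomial_function q" for q
  proof -
    have "(\<lambda>y. G y * of_real (q (fexp b 1 y))) integrable_on {0..b}"
      using assms(2) q
        by (intro continuous_intros integrable_continuous_real continuous_on_real_polynomial_fexp)
    moreover have "integral {0..b} (\<lambda>y. G y * of_real (q (fexp b 1 y))) = 0"
      using fourier_coeffs_zero_mult[OF q assms(2,4,1), of 0] assms(1) by (simp add: fourier_coeff_def)
    ultimately show ?thesis by (metis integrable_integral)
  qed
  define J where "J = integral {0..b} (\<lambda>y. (norm (G y))\<^sup>2)"
  have contG: "continuous_on {0..b} (\<lambda>y. (norm (G y))\<^sup>2)"
    using assms(2) by (intro continuous_intros)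
  have J: "((\<lambda>y. (norm (G y))\<^sup>2) has_integral J) {0..b}"
    unfolding J_def by (intro integrable_integral integrable_continuous_real contG)
  have J0: "J \<ge> 0" using has_integral_nonneg[OF J] by simp
  have small: "J \<le> \<epsilon> * (B * b)" if \<epsilon>: "\<epsilon> > 0" for \<epsilon>
  proof -
    obtain p where p: "polynomial_function p" "\<And>z. z \<in> sphere 0 1 \<Longrightarrow> norm (g z - p z) < \<epsilon>"
      using Stone_Weierstrass_polynomial_function[OF _ g(1) \<epsilon>] by auto
    \<comment> \<open>Orthogonality is available for real-valued polynomial functions, so p is split
      into real and imaginary part.\<close>
    have "real_polynomial_function (Re \<circ> p)" "real_polynomial_function (Im \<circ> p)"
      using p(1) bounded_linear_Re bounded_linear_Im unfolding polynomial_function_def by blast+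
    then have "((\<lambda>y. G y * of_real ((Re \<circ> p) (fexp b 1 y)) +
      \<i> * (G y * of_real ((Im \<circ> p) (fexp b 1 y))))
        has_integral 0 + \<i> * 0) {0..b}"
      by (intro has_integral_add has_integral_mult_right *)
    moreover have "G y * of_real ((Re \<circ> p) (fexp b 1 y)) + \<i> * (G y * of_real ((Im \<circ> p) (fexp b 1 y)))
       = G y * p (fexp b 1 y)" for y
      by (simp add: complex_eq_iff algebra_simps)
    ultimately have "((\<lambda>y. G y * p (fexp b 1 y)) has_integral 0) {0..b}" by simp
    moreover have "((\<lambda>y. complex_of_real ((norm (G y))\<^sup>2)) has_integral of_real J) {0..b}"
      using has_integral_linear[OF J bounded_linear_of_real[where 'a=complex]] by (simp add: o_def)
    ultimately have "((\<lambda>y. complex_of_real ((norm (G y))\<^sup>2) - G y * p (fexp b 1 y))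
      has_integral of_real J - 0) {0..b}"
      by (intro has_integral_diff)
    then have "((\<lambda>y. complex_of_real ((norm (G y))\<^sup>2) - G y * p (fexp b 1 y))
      has_integral of_real J) {0..b}"
      by simp
    then have "norm (complex_of_real J) \<le> (B * \<epsilon>) * measure lborel {0..b}"
    proof (rule has_integral_bound_real[where S="{}", rotated 2])
      fix y assume y: "y \<in> {0..b} - {}"
      have "complex_of_real ((norm (G y))\<^sup>2) - G y * p (fexp b 1 y) =
        G y * (g (fexp b 1 y) - p (fexp b 1 y))"
        using y g(2)[of y] by (simp only: complex_norm_square) (simp add: algebra_simps)
      also have "norm \<dots> \<le> B * \<epsilon>"
        unfolding norm_mult using y p(2)[of "fexp b 1 y"] B
        by (intro mult_mono) auto
      finally show "norm (complex_of_real ((norm (G y))\<^sup>2) - G y * p (fexp b 1 y)) \<le> B * \<epsilon>" .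
    qed (use B that in auto)
    then show ?thesis using J0 assms(1) by (simp add: mult_ac)
  qed
  have "J \<le> 0"
  proof (rule ccontr)
    assume "\<not> J \<le> 0"
    \<comment> \<open>This \<epsilon> turns the estimate into \<open>J \<le> J / 2\<close>.\<close>
    then have "J \<le> J / (2 * (B * b)) * (B * b)" using B assms(1) by (intro small) auto
    then show False using \<open>\<not> J \<le> 0\<close> B assms(1) by (simp add: field_simps)
  qed
  then have "\<forall>y\<in>{0..b}. (norm (G y))\<^sup>2 = 0"
    using integral_eq_0_iff[OF contG assms(1)] J0 by (simp add: J_def)
  then show ?thesis using assms(5) by simp
qed

text \<open>Absolute summability makes the series converge uniformly to a continuous periodic S, and
  termwise integration shows that S has the coefficients of F. The difference F - S is then zero by
  uniqueness.\<close>

theorem fourier_inversion: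
  fixes F :: "real \<Rightarrow> complex"
  assumes "b > 0" "continuous_on {0..b} F" "F 0 = F b"
    and summ: "(\<lambda>k. norm (fourier_coeff b F k)) summable_on UNIV"
    and "y \<in> {0..b}"
  shows "((\<lambda>k. fourier_coeff b F k * fexp b k y) has_sum F y) UNIV"
proof -
  define c where "c = fourier_coeff b F"
  define S where "S y = (\<Sum>\<^sub>\<infinity>k. c k * fexp b k y)" for y
  have unif: "uniform_limit {0..b} (\<lambda>X y. \<Sum>k\<in>X. c k * fexp b k y) S (finite_subsets_at_top UNIV)"
    unfolding S_def by (rule Weierstrass_m_test_general[OF _ summ]) (auto simp: norm_mult c_def)
  have hs: "((\<lambda>k. c k * fexp b k y) has_sum S y) UNIV" for y
    unfolding S_def
    by (rule has_sum_infsum, rule abs_summable_summable) (use summ in \<open>simp add: norm_mult c_def\<close>)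
  have contS: "continuous_on {0..b} S"
    by (rule uniform_limit_theorem[OF _ unif])
       (auto intro!: always_eventually continuous_intros)
  have "fourier_coeff b S l = c l" for l
  proof -
    have u: "uniform_limit {0..b} (\<lambda>X y. (\<Sum>k\<in>X. c k * fexp b k y) * fexp b (- l) y) (\<lambda>y. S y * fexp b (- l) y)
        (finite_subsets_at_top UNIV)"
    proof (rule uniform_lim_mult[OF unif uniform_limit_const])
      show "bounded (S ` {0..b})"
        using contS by (intro compact_imp_bounded compact_continuous_image) auto
      show "bounded (fexp b (- l) ` {0..b})"
        by (intro compact_imp_bounded compact_continuous_image continuous_on_fexp) auto
    qed
    obtain I J where I: "\<And>X. ((\<lambda>y. (\<Sum>k\<in>X. c k * fexp b k y) * fexp b (- l) y) has_integral I X) {0..b}"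
      and J: "((\<lambda>y. S y * fexp b (- l) y) has_integral J) {0..b}"
      and lim: "(I \<longlongrightarrow> J) (finite_subsets_at_top UNIV)"
      by (rule uniform_limit_integral[OF u]) (auto intro!: continuous_intros)
    \<comment> \<open>Along the net of finite sets the integrals do not merely converge: they are
      constant as soon as l belongs to X.\<close>
    have "I X = of_real b * c l" if "finite X" "l \<in> X" for X
    proof -
      have "((\<lambda>y. \<Sum>k\<in>X. c k * fexp b (k - l) y) has_integral
          (\<Sum>k\<in>X. c k * (if k - l = 0 then of_real b else 0))) {0..b}"
        using that assms(1) by (intro has_integral_sum has_integral_mult_right integral_fexp) auto
      also have "(\<Sum>k\<in>X. c k * (if k - l = 0 then of_real b else 0)) = of_real b * c l"
        using that by (simp add: if_distrib sum.delta cong: if_cong)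
      also have "(\<lambda>y. \<Sum>k\<in>X. c k * fexp b (k - l) y) = (\<lambda>y. (\<Sum>k\<in>X. c k * fexp b k y) * fexp b (- l) y)"
        using fexp_add[of b _ "- l"] by (simp add: sum_distrib_right mult.assoc)
      finally show ?thesis using I has_integral_unique by blast
    qed
    moreover have "\<forall>\<^sub>F X in finite_subsets_at_top UNIV. finite X \<and> l \<in> X"
      by (auto simp: eventually_finite_subsets_at_top intro!: exI[of _ "{l}"])
    ultimately have "(I \<longlongrightarrow> of_real b * c l) (finite_subsets_at_top UNIV)"
      by (intro tendsto_eventually) (auto elim!: eventually_mono)
    then have "J = of_real b * c l"
      using lim tendsto_unique finite_subsets_at_top_neq_bot by blast
    then show ?thesis
      using J assms(1) by (simp add: fourier_coeff_def integral_unique)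
  qed
  moreover have "fourier_coeff b (\<lambda>y. F y - S y) l = fourier_coeff b F l - fourier_coeff b S l" for l
    unfolding fourier_coeff_def left_diff_distrib diff_divide_distrib[symmetric]
    by (subst integral_diff)
       (auto intro!: integrable_continuous_real continuous_intros contS assms)
  ultimately have "fourier_coeff b (\<lambda>y. F y - S y) l = 0" for l
    by (simp add: c_def)
  moreover have "S 0 = S b"
    using assms(1) by (simp add: S_def fexp_period)
  ultimately have "F y - S y = 0"
    using assms
      by (intro fourier_coeffs_zero_imp_zero[of b "\<lambda>y. F y - S y"] continuous_intros contS) auto
  then show ?thesis using hs[of y] by (simp add: c_def)
qed

section \<open>Trigonometric interpolation\<close>

lemma fexp_diff: "fexp b k (x - y) = fexp b k x * fexp b (- k) y"
  by (simp add: fexp_def cis_mult ring_distribs diff_divide_distrib)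

text \<open>Telescoping after multiplication by \<open>cis \<psi> - cis (- \<psi>)\<close>.\<close>
lemma sum_cis_window:
  "(\<Sum>i<N. cis (2 * (a + real i) * \<psi>)) * (2 * \<i> * sin \<psi>) =
     cis ((2 * a + 2 * real N - 1) * \<psi>) - cis ((2 * a - 1) * \<psi>)"
proof (induction N)
  case (Suc N)
  have "2 * \<i> * sin \<psi> = cis \<psi> - cis (- \<psi>)"
    by (simp add: complex_eq_iff)
  then have "cis (2 * (a + real N) * \<psi>) * (2 * \<i> * sin \<psi>) =
      cis (2 * (a + real N) * \<psi> + \<psi>) - cis (2 * (a + real N) * \<psi> + - \<psi>)"
    by (simp only: right_diff_distrib cis_mult)
  also have "2 * (a + real N) * \<psi> + \<psi> = (2 * a + 2 * real (Suc N) - 1) * \<psi>"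
    by (simp add: algebra_simps)
  also have "2 * (a + real N) * \<psi> + - \<psi> = (2 * a + 2 * real N - 1) * \<psi>"
    by (simp add: algebra_simps)
  finally show ?case
    by (simp only: sum.lessThan_Suc distrib_right Suc.IH) simp
qed simp

text \<open>The Nyquist term \<open>cos\<close> splits evenly between the frequencies \<open>K\<close> and \<open>-K\<close>.\<close>
lemma cardinal_fun_eq_fexp_windows:
  assumes b: "b > 1" and n: "n > 0" and K: "real n * b = 2 * real K"
    and x: "x \<in> {0..1}" and j: "j < 2 * K"
  shows "complex_of_real (cardinal_fun b n j x) =
    ((\<Sum>i<2*K. fexp b (- int K + int i) (x - grid_pt n j)) +
     (\<Sum>i<2*K. fexp b (1 - int K + int i) (x - grid_pt n j))) / of_nat (4 * K)"
proof -
  have Kpos: "K > 0" using j by simp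
  define \<psi> where "\<psi> = pi * (real n * x - real j) / (2 * real K)"
  have fe: "fexp b l (x - grid_pt n j) = cis (2 * real_of_int l * \<psi>)" for l
  proof -
    have "2 * pi * real_of_int l * (x - grid_pt n j) / b =
      2 * real_of_int l * (pi * (real n * x - real j) / (real n * b))"
      using n b by (simp add: grid_pt_def field_simps)
    then show ?thesis by (simp only: fexp_def \<psi>_def K)
  qed
  show ?thesis
  proof (cases "x = grid_pt n j")
    case True
    then show ?thesis using Kpos by (simp add: cardinal_fun_def)
  next
    case False
    have xj: "real n * x - real j \<noteq> 0" using False n by (simp add: grid_pt_def field_simps)
    \<comment> \<open>Here \<open>x \<le> 1 < b\<close> enters: it keeps \<psi> strictly between -pi
      and pi, where the sine vanishes only at 0.\<close>
    have "real n * x \<le> real n" using x by (simp add: mult_left_le)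
    moreover have "real n < real n * b" using n b by simp
    ultimately have "real n * x - real j < 2 * real K" using K by simp
    moreover have "- (2 * real K) < real n * x - real j"
    proof -
      have "real j < 2 * real K" using j by linarith
      moreover have "real n * x \<ge> 0" using x by simp
      ultimately show ?thesis by linarith
    qed
    ultimately have "\<bar>(real n * x - real j) / (2 * real K)\<bar> < 1"
      using Kpos by (simp add: abs_less_iff divide_less_eq)
    then have "pi * \<bar>(real n * x - real j) / (2 * real K)\<bar> < pi * 1"
      by (intro mult_strict_left_mono) auto
    then have "\<bar>\<psi>\<bar> < pi"
      by (simp add: \<psi>_def abs_mult)
    moreover have "\<psi> \<noteq> 0" using xj Kpos by (simp add: \<psi>_def)
    ultimately have s: "sin \<psi> \<noteq> 0"
      using sin_eq_0_pi[of \<psi>] by (auto simp: abs_less_iff)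
    have w: "(\<Sum>i<2*K. cis (2 * real_of_int (a + int i) * \<psi>)) * (2 * \<i> * sin \<psi>) =
      cis ((2 * real_of_int a + 4 * real K - 1) * \<psi>) - cis ((2 * real_of_int a - 1) * \<psi>)" for a
      using sum_cis_window[of "real_of_int a" \<psi> "2 * K"] by simp
    let ?S = "(\<Sum>i<2*K. cis (2 * real_of_int (- int K + int i) * \<psi>)) +
      (\<Sum>i<2*K. cis (2 * real_of_int (1 - int K + int i) * \<psi>))"
    define S0 where "S0 = ?S"
    have "?S * (2 * \<i> * sin \<psi>) =
      cis ((2 * real K - 1) * \<psi>) - cis (- ((2 * real K + 1) * \<psi>)) +
        (cis ((2 * real K + 1) * \<psi>) - cis (- ((2 * real K - 1) * \<psi>)))"
    proof -
      have "2 * real_of_int (- int K) + 4 * real K - 1 = 2 * real K - 1"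
        "(2 * real_of_int (- int K) - 1) * \<psi> = - ((2 * real K + 1) * \<psi>)"
        "2 * real_of_int (1 - int K) + 4 * real K - 1 = 2 * real K + 1"
        "(2 * real_of_int (1 - int K) - 1) * \<psi> = - ((2 * real K - 1) * \<psi>)"
        by (simp_all add: algebra_simps)
      then show ?thesis by (simp only: distrib_right[of _ _ "2 * \<i> * complex_of_real (sin \<psi>)"] w)
    qed
    also have "\<dots> = 2 * \<i> * (sin ((2 * real K - 1) * \<psi>) + sin ((2 * real K + 1) * \<psi>))"
      by (simp add: complex_eq_iff)
    \<comment> \<open>The two windows produce the sines of \<open>(2K - 1) \<psi>\<close> and
      \<open>(2K + 1) \<psi>\<close>. Their difference is
      \<open>2 cos (2K \<psi>) sin \<psi>\<close>; after division by \<open>sin \<psi>\<close> it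
      becomes the cosine term of the cardinal function.\<close>
    also have "sin ((2 * real K + 1) * \<psi>) =
      sin ((2 * real K - 1) * \<psi>) + 2 * cos (2 * real K * \<psi>) * sin \<psi>"
    proof -
      have "(2 * real K + 1) * \<psi> = 2 * real K * \<psi> + \<psi>" "(2 * real K - 1) * \<psi> = 2 * real K * \<psi> - \<psi>"
        by (simp_all add: algebra_simps)
      then show ?thesis by (simp only: sin_add sin_diff)
    qed
    finally have "2 * \<i> * (?S * complex_of_real (sin \<psi>)) = 2 * \<i> *
       of_real (2 * (sin ((2 * real K - 1) * \<psi>) + cos (2 * real K * \<psi>) * sin \<psi>))"
      unfolding S0_def[symmetric] by (simp add: algebra_simps)
    then have "?S * complex_of_real (sin \<psi>) =
       of_real (2 * (sin ((2 * real K - 1) * \<psi>) + cos (2 * real K * \<psi>) * sin \<psi>))"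
      by (rule mult_left_cancel[THEN iffD1, rotated]) simp
    then have S: "?S = of_real (2 * (sin ((2 * real K - 1) * \<psi>) / sin \<psi> + cos (2 * real K * \<psi>)))"
      unfolding S0_def[symmetric] using s by (simp add: field_simps)
    have e1: "pi * (real n * b - 1) * (real j - real n * x) / (real n * b) = - ((2 * real K - 1) * \<psi>)"
      using Kpos unfolding K by (simp add: \<psi>_def field_simps)
    have e2: "pi * (real j - real n * x) / (real n * b) = - \<psi>"
      using Kpos unfolding K by (simp add: \<psi>_def field_simps)
    have e3: "pi * (real j - real n * x) = - (2 * real K * \<psi>)"
      using Kpos by (simp add: \<psi>_def field_simps)
    have "cardinal_fun b n j x =
      1 / (2 * real K) * (sin ((2 * real K - 1) * \<psi>) / sin \<psi> + cos (2 * real K * \<psi>))"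
      using False unfolding cardinal_fun_def e1 e2 e3 by (simp add: K)
    also have "\<dots> = 2 * (sin ((2 * real K - 1) * \<psi>) / sin \<psi> + cos (2 * real K * \<psi>)) / real (4 * K)"
      by (simp del: distrib_left_numeral)
    finally show ?thesis unfolding fe S by (simp only: of_real_divide of_real_of_nat_eq)
  qed
qed

section \<open>Discrete orthogonality and aliasing\<close>

lemma dvd_abs_less_imp_eq_0:
  fixes m d :: int
  assumes "m dvd d" "\<bar>d\<bar> < m"
  shows "d = 0"
  using dvd_imp_le_int[of d m] assms by linarith

text \<open>The summands are the powers of an N-th root of unity, and this root is 1 exactly when N
  divides k.\<close>

lemma sum_fexp_grid:
  assumes n: "n > 0" and N: "real n * b = real N" "N > 0"
  shows "(\<Sum>j<N. fexp b k (grid_pt n j)) = (if int N dvd k then of_nat N else 0)"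
proof -
  define z where "z = cis (2 * pi * real_of_int k / real N)"
  have fe: "fexp b k (grid_pt n j) = z ^ j" for j
  proof -
    have "b \<noteq> 0" using N by auto
    have "2 * pi * real_of_int k * grid_pt n j / b = real j * (2 * pi * real_of_int k / real N)"
      unfolding N(1)[symmetric] by (simp add: grid_pt_def)
    then show ?thesis by (simp add: fexp_def z_def Complex.DeMoivre)
  qed
  have z1: "z = 1 \<longleftrightarrow> int N dvd k"
  proof -
    have "z = 1 \<longleftrightarrow> (\<exists>m::int. 2 * pi * real_of_int k / real N = real_of_int (2 * m) * pi)"
      unfolding z_def cis_conv_exp exp_eq_1 by simp
    also have "\<dots> \<longleftrightarrow> (\<exists>m::int. real_of_int k = real_of_int (m * int N))"
      using N by (intro ex_cong1) (auto simp: field_simps)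
    also have "\<dots> \<longleftrightarrow> int N dvd k"
      unfolding of_int_eq_iff by (auto simp: dvd_def mult.commute)
    finally show ?thesis .
  qed
  have "z ^ N = 1"
    using N cis_multiple_2pi[of "of_int k"] by (simp add: z_def Complex.DeMoivre)
  then show ?thesis
    using z1 geometric_sum[of z N] by (cases "z = 1") (auto simp: fe)
qed

text \<open>Aliasing: N consecutive integers contain exactly one k' congruent to k modulo N, and
  discrete orthogonality removes all other frequencies of the window. The free start a lets both
  windows be treated at once.\<close>

lemma interpolate_fexp_window:
  assumes n: "n > 0" and N: "real n * b = real N" "N > 0"
  obtains k' where "k' \<in> {a..<a + int N}" "int N dvd k - k'"
    "(\<Sum>j<N. fexp b k (grid_pt n j) * (\<Sum>i<N. fexp b (a + int i) (x - grid_pt n j))) =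
      of_nat N * fexp b k' x"
proof
  define i0 where "i0 = nat ((k - a) mod int N)"
  have i0: "i0 < N" "int i0 = (k - a) mod int N"
    using N by (auto simp: i0_def nat_less_iff)
  show "a + int i0 \<in> {a..<a + int N}" using i0 by auto
  show dvd: "int N dvd k - (a + int i0)"
    using i0 by (simp add: minus_mod_eq_mult_div flip: diff_diff_eq)
  have iff: "int N dvd k - (a + int i) \<longleftrightarrow> i = i0" if "i < N" for i
  proof
    assume "int N dvd k - (a + int i)"
    then have "int N dvd (k - (a + int i0)) - (k - (a + int i))" using dvd by (rule dvd_diff[rotated])
    then have "int N dvd int i - int i0" by simp
    moreover have "\<bar>int i - int i0\<bar> < int N" using that i0 by auto
    ultimately have "int i - int i0 = 0" by (rule dvd_abs_less_imp_eq_0)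
    then show "i = i0" by simp
  qed (use dvd in simp)
  have "(\<Sum>j<N. fexp b k (grid_pt n j) * (\<Sum>i<N. fexp b (a + int i) (x - grid_pt n j))) =
    (\<Sum>i<N. fexp b (a + int i) x * (\<Sum>j<N. fexp b (k - (a + int i)) (grid_pt n j)))"
    unfolding sum_distrib_left
    by (subst sum.swap) (simp add: fexp_diff mult_ac fexp_add[of b k "- _", simplified])
  also have "\<dots> = (\<Sum>i<N. if i = i0 then of_nat N * fexp b (a + int i) x else 0)"
    unfolding sum_fexp_grid[OF assms] by (intro sum.cong) (auto simp: iff)
  also have "\<dots> = of_nat N * fexp b (a + int i0) x"
    using i0 by simp
  finally show "(\<Sum>j<N. fexp b k (grid_pt n j) * (\<Sum>i<N. fexp b (a + int i) (x - grid_pt n j))) =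
      of_nat N * fexp b (a + int i0) x" .
qed

text \<open>The interpolant of an exponential is the mean of its aliases in the two windows. A
  frequency with \<open>\<bar>k\<bar> < K\<close> lies in both windows and is its own alias.
  Otherwise the mean has modulus at most 1, and so has the exponential itself, whence the 2.\<close>

lemma interpolation_error_fexp:
  fixes b n K k x
  defines "E \<equiv> (\<Sum>j<2*K. fexp b k (grid_pt n j) * of_real (cardinal_fun b n j x)) - fexp b k x"
  assumes b: "b > 1" and n: "n > 0" and K: "real n * b = 2 * real K" and x: "x \<in> {0..1}"
  shows "norm E \<le> 2" and "\<bar>k\<bar> < int K \<Longrightarrow> E = 0"
proof -
  have "real n * b > 0" using n b by simp
  then have Kpos: "K > 0" using K by simp
  have K': "real n * b = real (2 * K)" using K by simp
  obtain k1 where k1: "k1 \<in> {- int K..<- int K + int (2 * K)}" "int (2 * K) dvd k - k1"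
    "(\<Sum>j<2 * K. fexp b k (grid_pt n j) * (\<Sum>i<2 * K. fexp b (- int K + int i) (x - grid_pt n j))) =
      of_nat (2 * K) * fexp b k1 x"
    by (rule interpolate_fexp_window[OF n K', of "- int K" k x]) (use Kpos in auto)
  obtain k2 where k2: "k2 \<in> {1 - int K..<1 - int K + int (2 * K)}" "int (2 * K) dvd k - k2"
    "(\<Sum>j<2 * K. fexp b k (grid_pt n j) * (\<Sum>i<2 * K. fexp b (1 - int K + int i) (x - grid_pt n j))) =
      of_nat (2 * K) * fexp b k2 x"
    by (rule interpolate_fexp_window[OF n K', of "1 - int K" k x]) (use Kpos in auto)
  have "(\<Sum>j<2*K. fexp b k (grid_pt n j) * of_real (cardinal_fun b n j x)) =
    ((\<Sum>j<2 * K. fexp b k (grid_pt n j) * (\<Sum>i<2 * K. fexp b (- int K + int i) (x - grid_pt n j))) +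
     (\<Sum>j<2 * K. fexp b k (grid_pt n j) * (\<Sum>i<2 * K. fexp b (1 - int K +
       int i) (x - grid_pt n j)))) / of_nat (4 * K)"
    unfolding sum.distrib[symmetric] sum_divide_distrib
    using cardinal_fun_eq_fexp_windows[OF b n K x]
    by (intro sum.cong refl) (simp add: distrib_left add_divide_distrib)
  also have "\<dots> = (fexp b k1 x + fexp b k2 x) / 2"
    unfolding k1 k2 using Kpos by (simp add: field_simps)
  finally have E: "E = (fexp b k1 x + fexp b k2 x) / 2 - fexp b k x" by (simp add: E_def)
  have "norm E \<le> norm ((fexp b k1 x + fexp b k2 x) / 2) + norm (fexp b k x)"
    unfolding E by (rule norm_triangle_ineq4)
  also have "\<dots> \<le> 2"
    using norm_triangle_ineq[of "fexp b k1 x" "fexp b k2 x"] by (simp add: norm_divide)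
  finally show "norm E \<le> 2" .
  show "E = 0" if "\<bar>k\<bar> < int K"
  proof -
    have "\<bar>k - k1\<bar> < int (2 * K)" "\<bar>k - k2\<bar> < int (2 * K)" using k1(1) k2(1) that by auto
    then have "k - k1 = 0" "k - k2 = 0"
      using k1(2) k2(2) by (blast intro: dvd_abs_less_imp_eq_0)+
    then show ?thesis by (simp add: E)
  qed
qed

section \<open>Tail sums and the error of trigonometric interpolation\<close>

text \<open>Since \<open>t * (t + 1) \<le> 2 * t * t\<close> for \<open>t \<ge> 1\<close>, the term
  \<open>2 / (t * (t + 1))\<close> dominates the inverse square. It telescopes, so the tail has an
  exact value: 2 / K from each sign of k.\<close>

lemma has_sum_inverse_squares_majorant:
  fixes K :: nat
  assumes "K > 0"
  shows "((\<lambda>k::int. 2 / real_of_int \<bar>k\<bar> - 2 / (real_of_int \<bar>k\<bar> + 1))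
      has_sum 4 / real K) {k. \<bar>k\<bar> \<ge> int K}"
proof -
  let ?g = "\<lambda>k::int. 2 / real_of_int \<bar>k\<bar> - 2 / (real_of_int \<bar>k\<bar> + 1)"
  have lim: "(\<lambda>i. 2 / (real K + real i)) \<longlonglongrightarrow> 0"
    by (intro tendsto_divide_0[OF tendsto_const] filterlim_at_top_imp_at_infinity
        filterlim_tendsto_add_at_top[OF tendsto_const] filterlim_real_sequentially)
  have "(\<lambda>i. 2 / (real K + real i) - 2 / (real K + real (Suc i))) sums (2 / (real K + real 0) - 0)"
    using lim by (rule telescope_sums')
  then have "((\<lambda>i. 2 / (real K + real i) - 2 / (real K + real (Suc i))) has_sum (2 / real K)) UNIV"
    using assms by (intro sums_nonneg_imp_has_sum) (auto simp: field_simps)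
  then have S: "((\<lambda>i. 2 / (real K + real i) - 2 / (real K + real i + 1)) has_sum (2 / real K)) UNIV"
    by (simp add: add_ac)
  have "(?g has_sum (2 / real K)) (range (\<lambda>i. int K + int i))"
    using S by (subst has_sum_reindex) (auto simp: inj_def o_def add_ac)
  moreover have "(?g has_sum (2 / real K)) (range (\<lambda>i. - (int K + int i)))"
    using S by (subst has_sum_reindex) (auto simp: inj_def o_def add_ac)
  moreover have "range (\<lambda>i. int K + int i) \<inter> range (\<lambda>i. - (int K + int i)) = {}"
    using assms by auto
  ultimately have "(?g
      has_sum (2 / real K + 2 / real K)) (range (\<lambda>i. int K + int i) \<union> range (\<lambda>i. - (int K + int i)))"
    by (rule has_sum_Un_disjoint)
  moreover have "range (\<lambda>i. int K + int i) \<union> range (\<lambda>i. - (int K + int i)) = {k. \<bar>k\<bar> \<ge> int K}"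
  proof (intro equalityI subsetI)
    fix k assume "k \<in> {k. \<bar>k\<bar> \<ge> int K}"
    then have "k = int K + int (nat (\<bar>k\<bar> - int K)) \<or> k = - (int K + int (nat (\<bar>k\<bar> - int K)))" by auto
    then show "k \<in> range (\<lambda>i. int K + int i) \<union> range (\<lambda>i. - (int K + int i))" by blast
  qed auto
  ultimately show ?thesis by simp
qed

lemma inverse_square_le_majorant:
  assumes "\<bar>k\<bar> \<ge> (1::int)"
  shows "1 / (real_of_int k)\<^sup>2 \<le> 2 / real_of_int \<bar>k\<bar> - 2 / (real_of_int \<bar>k\<bar> + 1)"
proof -
  define t where "t = real_of_int \<bar>k\<bar>"
  have t: "t \<ge> 1" using assms by (simp add: t_def)
  have "(real_of_int k)\<^sup>2 = t * t" by (simp add: t_def power2_eq_square flip: abs_mult)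
  moreover have "1 / (t * t) \<le> 2 / t - 2 / (t + 1)"
  proof -
    have "2 / t - 2 / (t + 1) = 1 / (t * (t + 1) / 2)" using t by (simp add: field_simps)
    moreover have "t * (t + 1) / 2 \<le> t * t" using t mult_left_mono[of 1 t t] by (simp add: field_simps)
    then have "1 / (t * t) \<le> 1 / (t * (t + 1) / 2)" using t by (intro frac_le) auto
    ultimately show ?thesis by linarith
  qed
  ultimately show ?thesis by (simp add: t_def)
qed

lemma has_sum_sum:
  fixes f :: "'i \<Rightarrow> 'a \<Rightarrow> 'b :: {topological_comm_monoid_add}"
  assumes "\<And>i. i \<in> I \<Longrightarrow> (f i has_sum S i) A"
  shows "((\<lambda>x. \<Sum>i\<in>I. f i x) has_sum (\<Sum>i\<in>I. S i)) A"
  using assms by (induction I rule: infinite_finite_induct) (auto intro: has_sum_add)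

lemma has_sum_diff:
  fixes f :: "'a \<Rightarrow> 'b :: {topological_ab_group_add}"
  assumes "(f has_sum S) A" "(g has_sum T) A"
  shows "((\<lambda>x. f x - g x) has_sum (S - T)) A"
  using has_sum_add[OF assms(1), of "\<lambda>x. - g x" "- T"] assms(2) by (simp add: has_sum_uminus)

text \<open>Interpolation is linear in finitely many values of F. Inserting the Fourier series at
  the grid points and at x writes the error as the sum of c_k times the error for the k-th
  exponential. Only \<open>\<bar>k\<bar> \<ge> K\<close> survives, with factor 2, and the tail sum 4
  / K gives the constant 8.\<close>

theorem trig_interpolation_error:
  fixes F :: "real \<Rightarrow> real" and A :: real
  assumes b: "b > 1" and n: "n > 0" and K: "real n * b = 2 * real K" and x: "x \<in> {0..1}"
    and cont: "continuous_on {0..b} F" and per: "F 0 = F b" and A: "A \<ge> 0"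
    and coeff: "\<And>k. \<bar>k\<bar> \<ge> int K \<Longrightarrow> norm (fourier_coeff b (\<lambda>y. of_real (F y)) k) \<le> A / (real_of_int k)\<^sup>2"
  shows "\<bar>(\<Sum>j<2*K. F (grid_pt n j) * cardinal_fun b n j x) - F x\<bar> \<le> 8 * A / real K"
proof -
  define c where "c = fourier_coeff b (\<lambda>y. complex_of_real (F y))"
  define g where "g k = 2 / real_of_int \<bar>k\<bar> - 2 / (real_of_int \<bar>k\<bar> + 1)" for k :: int
  have "real n * b > 0" using n b by simp
  then have Kpos: "K > 0" using K by simp
  have g: "(g has_sum 4 / real K) {k. \<bar>k\<bar> \<ge> int K}"
    unfolding g_def using has_sum_inverse_squares_majorant[OF Kpos] .
  have cg: "norm (c k) \<le> A * g k" if "\<bar>k\<bar> \<ge> int K" for k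
  proof -
    have "norm (c k) \<le> A * (1 / (real_of_int k)\<^sup>2)" using coeff[OF that] by (simp add: c_def)
    also have "\<dots> \<le> A * g k"
      unfolding g_def using that Kpos A by (intro mult_left_mono inverse_square_le_majorant) auto
    finally show ?thesis .
  qed
  have "(\<lambda>k. norm (c k)) summable_on {k. \<bar>k\<bar> \<ge> int K}"
  proof (rule summable_on_comparison_test)
    show "(\<lambda>k. A * g k) summable_on {k. \<bar>k\<bar> \<ge> int K}"
      using g by (intro summable_on_cmult_right) (auto simp: summable_on_def)
  qed (use cg in auto)
  \<comment> \<open>Nothing is known about the size of the low coefficients, but they are finitely
    many, so inversion still applies.\<close>
  moreover have "(\<lambda>k. norm (c k)) summable_on {- int K<..<int K}"
    by (rule summable_on_finite) simp
  ultimately have "(\<lambda>k. norm (c k)) summable_on ({k. \<bar>k\<bar> \<ge> int K} \<union> {- int K<..<int K})"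
    by (rule summable_on_union)
  moreover have "{k. \<bar>k\<bar> \<ge> int K} \<union> {- int K<..<int K} = UNIV" by auto
  ultimately have summ: "(\<lambda>k. norm (c k)) summable_on UNIV" by simp
  have inv: "((\<lambda>k. c k * fexp b k y) has_sum of_real (F y)) UNIV" if "y \<in> {0..b}" for y
    unfolding c_def using that b summ cont per
    by (intro fourier_inversion) (auto intro!: continuous_intros simp: c_def)
  define E where "E k =
      (\<Sum>j<2*K. fexp b k (grid_pt n j) * of_real (cardinal_fun b n j x)) - fexp b k x" for k
  have E: "norm (E k) \<le> 2" "\<bar>k\<bar> < int K \<Longrightarrow> E k = 0" for k
    unfolding E_def using interpolation_error_fexp[OF b n K x] by auto
  have grid: "grid_pt n j \<in> {0..b}" if "j < 2 * K" for j
  proof -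
    have "real j \<le> b * real n" using that K by (simp add: mult.commute)
    then show ?thesis using n by (simp add: grid_pt_def divide_le_eq)
  qed
  have "((\<lambda>k. (\<Sum>j<2*K. c k * fexp b k (grid_pt n j) * of_real (cardinal_fun b n j x)) - c k * fexp b k x) has_sum
     (\<Sum>j<2*K. of_real (F (grid_pt n j)) * of_real (cardinal_fun b n j x)) - of_real (F x)) UNIV"
    using x b by (intro has_sum_diff has_sum_sum has_sum_cmult_left inv grid) auto
  moreover have "(\<Sum>j<2*K. c k * fexp b k (grid_pt n j) * of_real (cardinal_fun b n j x)) - c k * fexp b k x = c k * E k" for k
    by (simp add: E_def right_diff_distrib sum_distrib_left mult.assoc)
  ultimately have "((\<lambda>k. c k * E k) has_sum
     (\<Sum>j<2*K. of_real (F (grid_pt n j)) * of_real (cardinal_fun b n j x)) - of_real (F x)) UNIV"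
    by simp
  also have "?this \<longleftrightarrow> ((\<lambda>k. c k * E k) has_sum
     (\<Sum>j<2*K. of_real (F (grid_pt n j)) * of_real (cardinal_fun b n j x)) - of_real (F x)) {k. \<bar>k\<bar> \<ge> int K}"
    by (rule has_sum_cong_neutral) (auto simp: E)
  finally have hs: "((\<lambda>k. c k * E k) has_sum
     (\<Sum>j<2*K. of_real (F (grid_pt n j)) * of_real (cardinal_fun b n j x)) - of_real (F x)) {k. \<bar>k\<bar> \<ge> int K}" .
  have "norm ((\<Sum>j<2*K. of_real (F (grid_pt n j)) * of_real (cardinal_fun b n j x)) - complex_of_real (F x)) \<le> (A * 2) * (4 / real K)"
  proof (rule norm_infsum_le[OF hs])
    show "((\<lambda>k. A * 2 * g k) has_sum A * 2 * (4 / real K)) {k. int K \<le> \<bar>k\<bar>}"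
      by (intro has_sum_cmult_right g)
    show "norm (c k * E k) \<le> A * 2 * g k" if "k \<in> {k. int K \<le> \<bar>k\<bar>}" for k
    proof -
      have "norm (c k * E k) \<le> (A * g k) * 2"
        unfolding norm_mult using that cg[of k] E(1)[of k]
        by (intro mult_mono) (auto intro: order_trans[OF norm_ge_zero cg])
      then show ?thesis by (simp add: mult_ac)
    qed
  qed
  moreover have "(\<Sum>j<2*K. of_real (F (grid_pt n j)) * of_real (cardinal_fun b n j x)) - complex_of_real (F x) =
     of_real ((\<Sum>j<2*K. F (grid_pt n j) * cardinal_fun b n j x) - F x)"
    by simp
  ultimately show ?thesis by (simp only: norm_of_real) (simp add: mult_ac)
qed

section \<open>Fourier coefficients of piecewise smooth functions\<close>

lemma has_integral_by_parts_fexp: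
  fixes D D' :: "real \<Rightarrow> real"
  assumes "\<alpha> \<le> \<beta>" "b \<noteq> 0" "k \<noteq> 0"
    and D: "\<And>y. y \<in> {\<alpha>..\<beta>} \<Longrightarrow> (D has_real_derivative D' y) (at y within {\<alpha>..\<beta>})"
    and cont: "continuous_on {\<alpha>..\<beta>} D'"
  defines "s \<equiv> \<i> * complex_of_real (2 * pi * of_int k / b)"
  shows "integral {\<alpha>..\<beta>} (\<lambda>y. of_real (D y) * fexp b (- k) y) =
    (of_real (D \<alpha>) * fexp b (- k) \<alpha> - of_real (D \<beta>) * fexp b (- k) \<beta>) / s +
    integral {\<alpha>..\<beta>} (\<lambda>y. of_real (D' y) * fexp b (- k) y) / s"
proof -
  have s: "s \<noteq> 0" using assms by (simp add: s_def)
  have s': "\<i> * of_real (2 * pi * of_int (- k) / b) = - s" by (simp add: s_def)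
  have ftc: "((\<lambda>y. of_real (D y) * (- s * fexp b (- k) y) + of_real (D' y) * fexp b (- k) y)
      has_integral
      of_real (D \<beta>) * fexp b (- k) \<beta> - of_real (D \<alpha>) * fexp b (- k) \<alpha>) {\<alpha>..\<beta>}"
  proof (rule fundamental_theorem_of_calculus[OF assms(1)])
    fix y assume y: "y \<in> {\<alpha>..\<beta>}"
    have "((\<lambda>y. complex_of_real (D y)) has_vector_derivative of_real (D' y)) (at y within {\<alpha>..\<beta>})"
      using D[OF y] by (rule has_vector_derivative_of_real)
    from has_vector_derivative_mult[OF this has_vector_derivative_fexp[of b "- k", unfolded s']]
    show "((\<lambda>y. complex_of_real (D y) * fexp b (- k) y) has_vector_derivative
        of_real (D y) * (- s * fexp b (- k) y) + of_real (D' y) * fexp b (- k) y) (at y within {\<alpha>..\<beta>})"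
      by simp
  qed
  have "continuous_on {\<alpha>..\<beta>} D"
    using D by (rule DERIV_continuous_on)
  then have "((\<lambda>y. of_real (D y) * fexp b (- k) y) has_integral
      integral {\<alpha>..\<beta>} (\<lambda>y. of_real (D y) * fexp b (- k) y)) {\<alpha>..\<beta>}"
    by (intro integrable_integral integrable_continuous_real continuous_intros)
  then have I1: "((\<lambda>y. - s * (of_real (D y) * fexp b (- k) y)) has_integral
      - s * integral {\<alpha>..\<beta>} (\<lambda>y. of_real (D y) * fexp b (- k) y)) {\<alpha>..\<beta>}"
    by (rule has_integral_mult_right)
  have I2: "((\<lambda>y. of_real (D' y) * fexp b (- k) y) has_integral
      integral {\<alpha>..\<beta>} (\<lambda>y. of_real (D' y) * fexp b (- k) y)) {\<alpha>..\<beta>}"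
    using cont by (intro integrable_integral integrable_continuous_real continuous_intros)
  have "of_real (D \<beta>) * fexp b (- k) \<beta> - of_real (D \<alpha>) * fexp b (- k) \<alpha> =
    - s * integral {\<alpha>..\<beta>} (\<lambda>y. of_real (D y) * fexp b (- k) y) +
      integral {\<alpha>..\<beta>} (\<lambda>y. of_real (D' y) * fexp b (- k) y)"
    using ftc has_integral_add[OF I1 I2] unfolding mult.left_commute[of "- s"]
    by (rule has_integral_unique)
  then show ?thesis using s by (simp add: field_simps)
qed

lemma iterated_by_parts_fexp:
  fixes D :: "nat \<Rightarrow> real \<Rightarrow> real"
  assumes "\<alpha> \<le> \<beta>" "b \<noteq> 0" "k \<noteq> 0"
    and D: "\<And>m y. y \<in> {\<alpha>..\<beta>} \<Longrightarrow> (D m has_real_derivative D (Suc m) y) (at y within {\<alpha>..\<beta>})"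
  defines "s \<equiv> \<i> * complex_of_real (2 * pi * of_int k / b)"
  shows "integral {\<alpha>..\<beta>} (\<lambda>y. of_real (D 0 y) * fexp b (- k) y) =
    (\<Sum>m<q. (of_real (D m \<alpha>) * fexp b (- k) \<alpha> - of_real (D m \<beta>) * fexp b (- k) \<beta>) / s ^ Suc m) +
    integral {\<alpha>..\<beta>} (\<lambda>y. of_real (D q y) * fexp b (- k) y) / s ^ q"
proof (induction q)
  case (Suc q)
  have "continuous_on {\<alpha>..\<beta>} (D (Suc q))"
    using D by (rule DERIV_continuous_on)
  from has_integral_by_parts_fexp[OF assms(1-3) D this, folded s_def]
  show ?case unfolding Suc.IH by (simp add: add_divide_distrib)
qed simp

text \<open>The jump of order m is divided by s to the power m + 1. As the modulus of s is at least
  n, all but two of these factors may be replaced by n. This yields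
  \<open>n^(m-d) * n^(1-m) = n^(1-d)\<close> for every m, which is why jumps may grow with m and be
  merely bounded at m = d. The remainder fits the same bound only with d + 1 factors of 1 / s, hence
  the number of integrations.\<close>

lemma fourier_coeff_bound_piecewise:
  fixes D P :: "nat \<Rightarrow> real \<Rightarrow> real"
  assumes b: "b > 1" and n: "n > 0" and K: "real n * b = 2 * real K" and d: "d \<ge> 1"
    and D: "\<And>m y. y \<in> {0..1} \<Longrightarrow> (D m has_real_derivative D (Suc m) y) (at y within {0..1})"
    and P: "\<And>m y. y \<in> {1..b} \<Longrightarrow> (P m has_real_derivative P (Suc m) y) (at y within {1..b})"
    and F1: "\<And>y. y \<in> {0..1} \<Longrightarrow> F y = D 0 y" and F2: "\<And>y. y \<in> {1..b} \<Longrightarrow> F y = P 0 y"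
    and per: "F 0 = F b"
    and J1: "\<And>m. 1 \<le> m \<Longrightarrow> m \<le> d \<Longrightarrow> \<bar>P m 1 - D m 1\<bar> \<le> C * (1 / real n) ^ (d - m)"
    and J2: "\<And>m. 1 \<le> m \<Longrightarrow> m \<le> d \<Longrightarrow> \<bar>D m 0 - P m b\<bar> \<le> C * (1 / real n) ^ (d - m)"
    and B1: "\<And>y. y \<in> {0..1} \<Longrightarrow> \<bar>D (Suc d) y\<bar> \<le> C"
    and B2: "\<And>y. y \<in> {1..b} \<Longrightarrow> \<bar>P (Suc d) y\<bar> \<le> C"
    and k: "\<bar>k\<bar> \<ge> int K"
  shows "norm (fourier_coeff b (\<lambda>y. of_real (F y)) k) \<le>
      (2 * real d + b) * C * b * (1 / real n) ^ (d - 1) / (real_of_int k)\<^sup>2"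
proof -
  define s where "s = \<i> * complex_of_real (2 * pi * of_int k / b)"
  have "real n * b > 0" using n b by simp
  then have Kpos: "K > 0" using K by simp
  have k0: "k \<noteq> 0" using k Kpos by auto
  have C: "C \<ge> 0" using order_trans[OF abs_ge_zero B1[of 0]] by simp
  have ns: "norm s = 2 * pi * \<bar>real_of_int k\<bar> / b"
    using b by (simp add: s_def norm_mult norm_divide)
  have kK: "\<bar>real_of_int k\<bar> \<ge> real K" using k by linarith
  \<comment> \<open>The cut-off \<open>K = n b / 2\<close> is proportional to n, so
    \<open>\<bar>k\<bar> \<ge> K\<close> gives
    \<open>2 * pi * \<bar>k\<bar> / b \<ge> pi * n\<close>.\<close>
  have "real n \<le> norm s"
  proof -
    have "real n = 2 * real K / b" using K b by (simp add: field_simps)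
    also have "\<dots> \<le> 2 * \<bar>real_of_int k\<bar> / b" using kK b by (intro divide_right_mono) auto
    also have "\<dots> \<le> pi * (2 * \<bar>real_of_int k\<bar> / b)"
      using pi_ge_two b by (intro mult_right_mono[of 1 pi, simplified]) auto
    finally show ?thesis by (simp add: ns mult_ac)
  qed
  then have inv_s: "1 / norm s \<le> 1 / real n" using n by (intro frac_le) auto
  have pow: "1 / norm s ^ Suc m \<le> (1 / norm s)\<^sup>2 * (1 / real n) ^ (m - 1)" if "m \<ge> 1" for m
  proof -
    have "1 / norm s ^ Suc m = (1 / norm s)\<^sup>2 * (1 / norm s) ^ (m - 1)"
      using that by (simp add: power_one_over flip: power_add)
    also have "\<dots> \<le> (1 / norm s)\<^sup>2 * (1 / real n) ^ (m - 1)"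
      using inv_s by (intro mult_left_mono power_mono) auto
    finally show ?thesis .
  qed
  define I1 where "I1 = integral {0..1} (\<lambda>y. of_real (D (Suc d) y) * fexp b (- k) y)"
  define I2 where "I2 = integral {1..b} (\<lambda>y. of_real (P (Suc d) y) * fexp b (- k) y)"
  \<comment> \<open>The exponential is 1 at both 0 and b, so the two outer boundary terms merge into
    one jump of the periodic continuation; the other jump sits at 1.\<close>
  define T where "T m = of_real (D m 0 - P m b) + of_real (P m 1 - D m 1) * fexp b (- k) 1" for m
  have "continuous_on {0..1} (D 0)" "continuous_on {1..b} (P 0)"
    "continuous_on {0..1} (D (Suc d))" "continuous_on {1..b} (P (Suc d))"
    by (rule DERIV_continuous_on[OF D] DERIV_continuous_on[OF P]; assumption)+
  note conts = this
  have int1: "(\<lambda>y. of_real (D 0 y) * fexp b (- k) y) integrable_on {0..1}"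
    and int2: "(\<lambda>y. of_real (P 0 y) * fexp b (- k) y) integrable_on {1..b}"
    and int3: "(\<lambda>y. of_real (D (Suc d) y) * fexp b (- k) y) integrable_on {0..1}"
    and int4: "(\<lambda>y. of_real (P (Suc d) y) * fexp b (- k) y) integrable_on {1..b}"
    by (intro integrable_continuous_real continuous_intros conts)+
  have hi1: "((\<lambda>y. of_real (F y) * fexp b (- k) y)
      has_integral integral {0..1} (\<lambda>y. of_real (D 0 y) * fexp b (- k) y)) {0..1}"
    by (rule has_integral_eq[OF _ integrable_integral[OF int1]]) (simp add: F1)
  have hi2: "((\<lambda>y. of_real (F y) * fexp b (- k) y)
      has_integral integral {1..b} (\<lambda>y. of_real (P 0 y) * fexp b (- k) y)) {1..b}"
    by (rule has_integral_eq[OF _ integrable_integral[OF int2]]) (simp add: F2)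
  have "((\<lambda>y. of_real (F y) * fexp b (- k) y) has_integral
     integral {0..1} (\<lambda>y. of_real (D 0 y) * fexp b (- k) y) +
       integral {1..b} (\<lambda>y. of_real (P 0 y) * fexp b (- k) y)) {0..b}"
    using hi1 hi2 b by (intro has_integral_combine[of 0 1 b]) auto
  then have "integral {0..b} (\<lambda>y. of_real (F y) * fexp b (- k) y) =
      integral {0..1} (\<lambda>y. of_real (D 0 y) * fexp b (- k) y) +
        integral {1..b} (\<lambda>y. of_real (P 0 y) * fexp b (- k) y)"
    by (rule integral_unique)
  also have "\<dots> = (\<Sum>m<Suc d. T m / s ^ Suc m) + (I1 + I2) / s ^ Suc d"
  proof -
    define U where "U m =
      (of_real (D m 0) * fexp b (- k) 0 - of_real (D m 1) * fexp b (- k) 1) / s ^ Suc m" for m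
    define V where "V m =
      (of_real (P m 1) * fexp b (- k) 1 - of_real (P m b) * fexp b (- k) b) / s ^ Suc m" for m
    have "integral {0..1} (\<lambda>y. of_real (D 0 y) * fexp b (- k) y) = (\<Sum>m<Suc d. U m) + I1 / s ^ Suc d"
      unfolding U_def s_def I1_def
        by (rule iterated_by_parts_fexp[where D=D, OF _ _ k0 D]) (use b in auto)
    moreover have "integral {1..b} (\<lambda>y. of_real (P 0 y) * fexp b (- k) y) =
      (\<Sum>m<Suc d. V m) + I2 / s ^ Suc d"
      unfolding V_def s_def I2_def
        by (rule iterated_by_parts_fexp[where D=P, OF _ _ k0 P]) (use b in auto)
    moreover have "T m / s ^ Suc m = U m + V m" for m
      unfolding U_def V_def add_divide_distrib[symmetric] using b
      by (simp add: T_def fexp_period left_diff_distrib del: power_Suc)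
    ultimately show ?thesis by (simp only: sum.distrib add_divide_distrib add_ac)
  qed
  also have "(\<Sum>m<Suc d. T m / s ^ Suc m) = (\<Sum>m=1..d. T m / s ^ Suc m)"
  proof -
    \<comment> \<open>\<open>F1\<close> and \<open>F2\<close> both evaluate F at 1, which makes the
      order 0 jump there vanish; the one across the period vanishes by \<open>per\<close>.\<close>
    have "T 0 = 0" using per F1[of 0] F2[of b] F1[of 1] F2[of 1] b by (simp add: T_def)
    then show ?thesis
      by (simp add: sum.lessThan_Suc_shift sum.atLeast1_atMost_eq del: sum.lessThan_Suc power_Suc)
  qed
  finally have eq: "integral {0..b} (\<lambda>y. of_real (F y) * fexp b (- k) y) =
      (\<Sum>m=1..d. T m / s ^ Suc m) + (I1 + I2) / s ^ Suc d" .
  define R where "R = (1 / norm s)\<^sup>2 * (1 / real n) ^ (d - 1)"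
  have "norm (T m / s ^ Suc m) \<le> 2 * C * R" if "m \<in> {1..d}" for m
  proof -
    have "norm (T m) \<le> \<bar>D m 0 - P m b\<bar> + \<bar>P m 1 - D m 1\<bar>"
      unfolding T_def
        by (rule order_trans[OF norm_triangle_ineq]) (simp only: norm_mult norm_of_real norm_fexp mult_1_right order_refl)
    also have "\<dots> \<le> 2 * (C * (1 / real n) ^ (d - m))"
      using J1[of m] J2[of m] that by simp
    finally have "norm (T m) * (1 / norm s ^ Suc m) \<le>
      (2 * (C * (1 / real n) ^ (d - m))) * ((1 / norm s)\<^sup>2 * (1 / real n) ^ (m - 1))"
      using pow[of m] that C by (intro mult_mono) auto
    also have "\<dots> = 2 * C * ((1 / norm s)\<^sup>2 * ((1 / real n) ^ (d - m) * (1 / real n) ^ (m - 1)))"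
      by (simp only: mult_ac)
    also have "(1 / real n) ^ (d - m) * (1 / real n) ^ (m - 1) = (1 / real n) ^ (d - 1)"
      unfolding power_add[symmetric] using that by simp
    finally show ?thesis by (simp add: norm_divide norm_mult norm_power R_def)
  qed
  then have "norm (\<Sum>m=1..d. T m / s ^ Suc m) \<le> (\<Sum>m=1..d. 2 * C * R)"
    by (rule sum_norm_le)
  moreover have "norm ((I1 + I2) / s ^ Suc d) \<le> C * b * R"
  proof -
    have "norm I1 \<le> C * measure lborel {0..1::real}"
      using integrable_integral[OF int3] unfolding I1_def[symmetric]
      by (rule has_integral_bound_real[where S="{}", OF C, rotated]) (use B1 in \<open>auto simp: norm_mult\<close>)
    moreover have "norm I2 \<le> C * measure lborel {1..b}"
      using integrable_integral[OF int4] unfolding I2_def[symmetric]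
      by (rule has_integral_bound_real[where S="{}", OF C, rotated]) (use B2 in \<open>auto simp: norm_mult\<close>)
    ultimately have "norm (I1 + I2) \<le> C * b"
      using norm_triangle_ineq[of I1 I2] b by (simp add: algebra_simps)
    then have "norm (I1 + I2) * (1 / norm s ^ Suc d) \<le> (C * b) * R"
      unfolding R_def using pow[OF d] b C by (intro mult_mono) auto
    then show ?thesis by (simp add: norm_divide norm_mult norm_power)
  qed
  ultimately have "norm (integral {0..b} (\<lambda>y. of_real (F y) * fexp b (- k) y)) \<le>
      (2 * real d + b) * C * R"
    unfolding eq by (intro order_trans[OF norm_triangle_ineq]) (simp add: algebra_simps)
  then have "norm (fourier_coeff b (\<lambda>y. of_real (F y)) k) \<le> (2 * real d + b) * C * R / b"
    using b by (simp add: fourier_coeff_def norm_divide divide_right_mono)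
  \<comment> \<open>So far: 2 C for each of the d jump orders and C b for the remainder. Passing
    from s to k costs the square of b, one factor of which cancels against the normalisation of the
    coefficient.\<close>
  also have "\<dots> \<le> (2 * real d + b) * C * ((b\<^sup>2 / (real_of_int k)\<^sup>2) * (1 / real n) ^ (d - 1)) / b"
  proof -
    have "1 / norm s \<le> b / \<bar>real_of_int k\<bar>"
    proof -
      have "1 / norm s = b / \<bar>real_of_int k\<bar> * (1 / (2 * pi))" using k0 b by (simp add: ns)
      also have "\<dots> \<le> b / \<bar>real_of_int k\<bar> * 1"
        using pi_ge_two b by (intro mult_left_mono) auto
      finally show ?thesis by simp
    qed
    then have "(1 / norm s)\<^sup>2 \<le> (b / \<bar>real_of_int k\<bar>)\<^sup>2"
      by (intro power_mono) auto
    then have "(1 / norm s)\<^sup>2 \<le> b\<^sup>2 / (real_of_int k)\<^sup>2" by (simp add: power_divide)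
    then show ?thesis
      unfolding R_def using b C by (intro divide_right_mono mult_left_mono mult_right_mono) auto
  qed
  also have "\<dots> = (2 * real d + b) * C * b * (1 / real n) ^ (d - 1) / (real_of_int k)\<^sup>2"
    using b by (simp add: power2_eq_square)
  finally show ?thesis .
qed

section \<open>Derivatives of interpolation errors\<close>

text \<open>The zeros are carried as a strictly increasing enumeration: neighbours bracket a zero of
  the next derivative, the brackets are disjoint, and so the new zeros are again in increasing
  order, one fewer in number.\<close>

lemma Rolle_iterated:
  fixes g :: "nat \<Rightarrow> real \<Rightarrow> real"
  assumes g: "\<And>m y. y \<in> {\<alpha>..\<beta>} \<Longrightarrow> (g m has_real_derivative g (Suc m) y) (at y within {\<alpha>..\<beta>})"
    and z: "strict_mono_on {..<d} z" "\<And>i. i < d \<Longrightarrow> z i \<in> {\<alpha>..\<beta>}" "\<And>i. i < d \<Longrightarrow> g 0 (z i) = 0"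
    and "m \<le> d"
  shows "\<exists>w. strict_mono_on {..<d - m} w \<and> (\<forall>i<d - m. w i \<in> {\<alpha>..\<beta>} \<and> g m (w i) = 0)"
  using \<open>m \<le> d\<close>
proof (induction m)
  case 0
  then show ?case using z by (intro exI[of _ z]) simp
next
  case (Suc m)
  then obtain w where w: "strict_mono_on {..<d - m} w" "\<And>i. i < d - m \<Longrightarrow> w i \<in> {\<alpha>..\<beta>}"
      "\<And>i. i < d - m \<Longrightarrow> g m (w i) = 0"
    by auto
  have "\<exists>v. w i < v \<and> v < w (Suc i) \<and> g (Suc m) v = 0" if "i < d - Suc m" for i
  proof -
    have i: "i < d - m" "Suc i < d - m" using that by auto
    have lt: "w i < w (Suc i)" using strict_mono_onD[OF w(1), of i "Suc i"] i by simp
    have sub: "{w i..w (Suc i)} \<subseteq> {\<alpha>..\<beta>}" using w(2)[OF i(1)] w(2)[OF i(2)] by auto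
    have "\<exists>v. w i < v \<and> v < w (Suc i) \<and> ((*) (g (Suc m) v)) = (\<lambda>v. 0)"
    proof (rule Rolle_deriv[OF lt])
      show "g m (w i) = g m (w (Suc i))" using w(3) i by simp
      show "continuous_on {w i..w (Suc i)} (g m)"
        using DERIV_continuous_on[OF g] sub by (rule continuous_on_subset)
      fix v assume v: "w i < v" "v < w (Suc i)"
      \<comment> \<open>Derivatives are only given within the closed interval; at interior points
        they are two-sided, as Rolle's theorem requires.\<close>
      then have "v \<in> interior {\<alpha>..\<beta>}" using w(2)[OF i(1)] w(2)[OF i(2)] by auto
      then have "(g m has_real_derivative g (Suc m) v) (at v)"
        using g[of v m] interior_subset by (metis at_within_interior subsetD)
      then show "(g m has_derivative (*) (g (Suc m) v)) (at v)"
        by (simp add: has_field_derivative_def)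
    qed
    then show ?thesis by (metis mult_1_right)
  qed
  then obtain v where v: "\<And>i. i < d - Suc m \<Longrightarrow> w i < v i \<and> v i < w (Suc i) \<and> g (Suc m) (v i) = 0"
    by metis
  have "strict_mono_on {..<d - Suc m} v"
  proof (rule strict_mono_onI)
    fix i j assume ij: "i \<in> {..<d - Suc m}" "j \<in> {..<d - Suc m}" "i < j"
    have "w (Suc i) \<le> w j"
      using strict_mono_on_leD[OF w(1), of "Suc i" j] ij by auto
    then show "v i < v j" using v[of i] v[of j] ij by auto
  qed
  moreover have "v i \<in> {\<alpha>..\<beta>}" if "i < d - Suc m" for i
  proof -
    have "w i \<in> {\<alpha>..\<beta>}" "w (Suc i) \<in> {\<alpha>..\<beta>}" using that by (intro w(2); linarith)+
    then show ?thesis using v[OF that] by auto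
  qed
  ultimately show ?case using v by (intro exI[of _ v]) auto
qed

text \<open>Every derivative of order below d has a zero in the interval. Descending from order d,
  the mean value inequality from such a zero gains one factor \<open>\<beta> - \<alpha>\<close> per
  order.\<close>

lemma derivative_bound_of_zeros:
  fixes g :: "nat \<Rightarrow> real \<Rightarrow> real"
  assumes g: "\<And>m y. y \<in> {\<alpha>..\<beta>} \<Longrightarrow> (g m has_real_derivative g (Suc m) y) (at y within {\<alpha>..\<beta>})"
    and z: "strict_mono_on {..<d} z" "\<And>i. i < d \<Longrightarrow> z i \<in> {\<alpha>..\<beta>}" "\<And>i. i < d \<Longrightarrow> g 0 (z i) = 0"
    and B: "\<And>y. y \<in> {\<alpha>..\<beta>} \<Longrightarrow> \<bar>g d y\<bar> \<le> M"
    and "m \<le> d" "x \<in> {\<alpha>..\<beta>}"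
  shows "\<bar>g m x\<bar> \<le> M * (\<beta> - \<alpha>) ^ (d - m)"
  using \<open>m \<le> d\<close> \<open>x \<in> {\<alpha>..\<beta>}\<close>
proof (induction m arbitrary: x rule: inc_induct)
  case base
  then show ?case using B by simp
next
  case (step m)
  have "\<exists>w. strict_mono_on {..<d - m} w \<and> (\<forall>i<d - m. w i \<in> {\<alpha>..\<beta>} \<and> g m (w i) = 0)"
    by (rule Rolle_iterated[OF g z]) (use step.hyps in auto)
  then obtain w where w: "w \<in> {\<alpha>..\<beta>}" "g m w = 0"
    using step.hyps by (metis zero_less_diff)
  \<comment> \<open>The sign comes from the induction hypothesis, where this quantity bounds an
    absolute value.\<close>
  have nn: "0 \<le> M * (\<beta> - \<alpha>) ^ (d - Suc m)"
    using step.IH[OF step.prems] by linarith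
  have "norm (g m x - g m w) \<le> M * (\<beta> - \<alpha>) ^ (d - Suc m) * norm (x - w)"
    by (rule field_differentiable_bound[OF _ g]) (use step w in auto)
  also have "\<dots> \<le> M * (\<beta> - \<alpha>) ^ (d - Suc m) * (\<beta> - \<alpha>)"
    using step.prems w by (intro mult_left_mono nn) auto
  also have "\<dots> = M * (\<beta> - \<alpha>) ^ (d - m)"
    using step.hyps by (simp add: Suc_diff_Suc flip: power_Suc2)
  finally show ?case using w by simp
qed

section \<open>Gram projections\<close>

lemma ip_left_commute: "ip_left d n f g = ip_left d n g f"
  by (simp add: ip_left_def mult.commute)

lemma ip_left_poly_add: "ip_left d n (poly (p + q)) g = ip_left d n (poly p) g + ip_left d n (poly q) g"
  by (simp add: ip_left_def sum.distrib distrib_right)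

lemma ip_left_poly_diff: "ip_left d n (poly (p - q)) g =
    ip_left d n (poly p) g - ip_left d n (poly q) g"
  by (simp add: ip_left_def sum_subtractf left_diff_distrib)

lemma ip_left_poly_smult: "ip_left d n (poly (smult c p)) g = c * ip_left d n (poly p) g"
  by (simp add: ip_left_def sum_distrib_left mult.assoc)

lemma ip_left_poly_sum: "ip_left d n (poly (\<Sum>k\<in>A. p k)) g = (\<Sum>k\<in>A. ip_left d n (poly (p k)) g)"
  unfolding ip_left_def poly_sum sum_distrib_right by (rule sum.swap)

lemmas ip_left_poly_simps = ip_left_poly_add ip_left_poly_diff ip_left_poly_smult ip_left_poly_sum

text \<open>The Gram-Schmidt vector before normalisation. Its coefficient of order l is 1, which is
  how it is seen to be nonzero.\<close>

definition gram_residual :: "nat \<Rightarrow> nat \<Rightarrow> nat \<Rightarrow> real poly" where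
  "gram_residual d n l = monom 1 l -
     (\<Sum>k<l. smult (ip_left d n (poly (monom 1 l)) (poly (gram_left d n k))) (gram_left d n k))"

lemma gram_left_residual:
  "gram_left d n l =
      smult (1 / sqrt (ip_left d n (poly (gram_residual d n l)) (poly (gram_residual d n l))))
     (gram_residual d n l)"
  by (subst gram_left.simps) (simp add: gram_residual_def Let_def)

lemma smult_sum_right: "smult c (\<Sum>k\<in>A. p k) = (\<Sum>k\<in>A. smult c (p k))"
  by (induction A rule: infinite_finite_induct) (auto simp: smult_add_right)

lemma degree_gram_left: "degree (gram_left d n l) \<le> l"
proof (induction l rule: less_induct)
  case (less l)
  have "degree (gram_residual d n l) \<le> l"
    unfolding gram_residual_def
  proof (intro degree_diff_le degree_sum_le)
    fix k assume "k \<in> {..<l}"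
    then show "degree (smult (ip_left d n (poly (monom 1 l)) (poly (gram_left d n k))) (gram_left d n k)) \<le> l"
      using less[of k] degree_smult_le[of _ "gram_left d n k"]
        by (meson lessThan_iff less_imp_le order_trans)
  qed (auto simp: degree_monom_le)
  then show ?case
    unfolding gram_left_residual using degree_smult_le order_trans by blast
qed

lemma degree_gram_residual: "degree (gram_residual d n l) \<le> l"
  unfolding gram_residual_def
  by (intro degree_diff_le degree_sum_le)
     (auto simp: degree_monom_le intro: order_trans[OF degree_smult_le] order_trans[OF degree_gram_left])

lemma coeff_gram_residual: "coeff (gram_residual d n l) l = 1"
proof -
  have "coeff (gram_left d n k) l = 0" if "k < l" for k
    using degree_gram_left[of d n k] that by (intro coeff_eq_0) simp
  then show ?thesis by (simp add: gram_residual_def coeff_sum)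
qed

lemma inj_grid_pt: "n > 0 \<Longrightarrow> inj_on (grid_pt n) A"
  by (auto simp: inj_on_def grid_pt_def)

text \<open>The form is only semidefinite on polynomials at large, but a nonzero polynomial of
  degree at most \<open>l < d\<close> cannot vanish at d distinct nodes. This makes the division by
  the norm legitimate.\<close>

lemma ip_left_residual_pos:
  assumes "n > 0" "l < d"
  shows "ip_left d n (poly (gram_residual d n l)) (poly (gram_residual d n l)) > 0"
proof -
  define q where "q = gram_residual d n l"
  have q0: "q \<noteq> 0" using coeff_gram_residual[of d n l] by (auto simp: q_def)
  have deg: "degree q \<le> l" unfolding q_def by (rule degree_gram_residual)
  have "\<exists>j<d. poly q (grid_pt n j) \<noteq> 0"
  proof (rule ccontr)
    assume "\<not> ?thesis"
    then have "grid_pt n ` {..<d} \<subseteq> {x. poly q x = 0}" by auto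
    then have "card (grid_pt n ` {..<d}) \<le> card {x. poly q x = 0}"
      using poly_roots_finite[OF q0] by (rule card_mono[rotated])
    also have "\<dots> \<le> l" using card_poly_roots_bound[OF q0] deg by linarith
    finally show False using assms by (simp add: card_image inj_grid_pt)
  qed
  then obtain j where j: "j < d" "poly q (grid_pt n j) \<noteq> 0" by blast
  then show ?thesis
    unfolding ip_left_def q_def[symmetric]
    by (intro sum_pos2[of _ j]) (auto simp: zero_less_mult_iff)
qed

text \<open>Ordering the indices fits the strong induction on the larger one; the opposite order
  follows by symmetry of the form.\<close>

lemma gram_left_orthonormal:
  assumes n: "n > 0" and "l < d" "k \<le> l"
  shows "ip_left d n (poly (gram_left d n l)) (poly (gram_left d n k)) = (if k = l then 1 else 0)"
  using assms(2,3)
proof (induction l arbitrary: k rule: less_induct)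
  case (less l)
  define q where "q = gram_residual d n l"
  define N where "N = ip_left d n (poly q) (poly q)"
  have N: "N > 0" unfolding N_def q_def by (rule ip_left_residual_pos[OF n less.prems(1)])
  have gl: "gram_left d n l = smult (1 / sqrt N) q"
    unfolding N_def q_def by (rule gram_left_residual)
  show ?case
  proof (cases "k = l")
    case True
    have "ip_left d n (poly (gram_left d n l)) (poly (gram_left d n l)) = 1 / sqrt N * (1 / sqrt N * N)"
      unfolding gl N_def
      by (simp only: ip_left_poly_smult ip_left_commute[of d n "poly q" "poly (smult _ q)"])
    then show ?thesis using N True by (simp add: real_div_sqrt)
  next
    case False
    then have k: "k < l" using less.prems by simp
    have orth: "ip_left d n (poly (gram_left d n i)) (poly (gram_left d n k)) =
      (if i = k then 1 else 0)" if "i < l" for i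
    proof (cases "k \<le> i")
      case True
      then show ?thesis using less.IH[of i k] that less.prems by auto
    next
      case False
      then show ?thesis
        using less.IH[of k i] k less.prems by (subst ip_left_commute) auto
    qed
    have "ip_left d n (poly q) (poly (gram_left d n k)) =
        ip_left d n (poly (monom 1 l)) (poly (gram_left d n k)) -
        (\<Sum>i<l. ip_left d n (poly (monom 1 l)) (poly (gram_left d n i)) * (if i = k then 1 else 0))"
      unfolding q_def gram_residual_def ip_left_poly_simps
      by (intro arg_cong2[of _ _ _ _ "(-)"] sum.cong refl) (auto simp: orth)
    also have "\<dots> = 0" using k by (simp add: if_distrib sum.delta cong: if_cong)
    finally show ?thesis using False by (simp only: gl ip_left_poly_smult) simp
  qed
qed

text \<open>The projection \<open>Pr\<close> is linear and fixes the Gram polynomials by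
  orthonormality. Read backwards, a Gram-Schmidt step expresses the monomial of degree l through
  Gram polynomials of index at most l, so \<open>Pr\<close> fixes monomials, hence all polynomials
  of degree below d.\<close>

lemma gram_left_reproduces:
  assumes n: "n > 0" and r: "degree r < d"
  shows "(\<Sum>l<d. smult (ip_left d n (poly r) (poly (gram_left d n l))) (gram_left d n l)) = r"
proof -
  define Pr where "Pr r =
      (\<Sum>l<d. smult (ip_left d n (poly r) (poly (gram_left d n l))) (gram_left d n l))" for r
  have Pr_add: "Pr (p + q) = Pr p + Pr q" for p q
    by (simp add: Pr_def ip_left_poly_add smult_add_left sum.distrib)
  have Pr_smult: "Pr (smult c p) = smult c (Pr p)" for c p
    by (simp only: Pr_def ip_left_poly_smult smult_sum_right smult_smult)
  have Pr_sum: "Pr (\<Sum>k\<in>A. g k) = (\<Sum>k\<in>A. Pr (g k))" for A :: "nat set" and g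
  proof -
    have "Pr 0 = 0" using Pr_smult[of 0 0] by simp
    then show ?thesis by (induction A rule: infinite_finite_induct) (auto simp: Pr_add)
  qed
  have Pr_gram: "Pr (gram_left d n l) = gram_left d n l" if "l < d" for l
  proof -
    have "ip_left d n (poly (gram_left d n l)) (poly (gram_left d n k)) = (if k = l then 1 else 0)"
      if "k < d" for k
      using gram_left_orthonormal[OF n, of l d k] gram_left_orthonormal[OF n, of k d l] that \<open>l < d\<close>
      by (cases "k \<le> l") (auto simp: ip_left_commute[of d n "poly (gram_left d n l)"])
    then have "Pr (gram_left d n l) = (\<Sum>k<d. smult (if k = l then 1 else 0) (gram_left d n k))"
      unfolding Pr_def by (intro sum.cong) auto
    also have "\<dots> = (\<Sum>k<d. if k = l then gram_left d n k else 0)"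
      by (intro sum.cong) auto
    finally show ?thesis using that by simp
  qed
  have Pr_monom: "Pr (monom 1 l) = monom 1 l" if "l < d" for l
  proof -
    define N where "N = ip_left d n (poly (gram_residual d n l)) (poly (gram_residual d n l))"
    have "N > 0" unfolding N_def using n that by (rule ip_left_residual_pos)
    then have "gram_residual d n l = smult (sqrt N) (gram_left d n l)"
      by (simp add: gram_left_residual[of d n l] flip: N_def)
    then have "monom 1 l = smult (sqrt N) (gram_left d n l) +
       (\<Sum>k<l. smult (ip_left d n (poly (monom 1 l)) (poly (gram_left d n k))) (gram_left d n k))"
      by (simp add: gram_residual_def algebra_simps)
    moreover have "Pr \<dots> = \<dots>"
      unfolding Pr_add Pr_sum Pr_smult using that by (simp add: Pr_gram)
    ultimately show ?thesis by metis
  qed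
  have "r = (\<Sum>i\<le>degree r. smult (coeff r i) (monom 1 i))"
    using poly_as_sum_of_monoms[of r] by (simp add: smult_monom)
  moreover have "Pr \<dots> = \<dots>"
    unfolding Pr_sum Pr_smult using r by (intro sum.cong) (auto simp: Pr_monom)
  ultimately show ?thesis unfolding Pr_def by metis
qed

section \<open>Gram projections as interpolants at the first and last d nodes\<close>

text \<open>Newton's scheme: a multiple of the nodal polynomial w corrects the value at the new node
  and changes nothing at the old ones.\<close>

lemma interpolating_poly_exists:
  fixes z v :: "nat \<Rightarrow> real"
  assumes "inj_on z {..d}"
  shows "\<exists>r. degree r \<le> d \<and> (\<forall>j\<le>d. poly r (z j) = v j)"
  using assms
proof (induction d)
  case 0
  show ?case by (intro exI[of _ "[:v 0:]"]) simp
next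
  case (Suc d)
  then obtain r where r: "degree r \<le> d" "\<forall>j\<le>d. poly r (z j) = v j"
    by (metis atMost_Suc inj_on_insert)
  define w where "w = (\<Prod>i\<le>d. [:- z i, 1:])"
  define c where "c = (v (Suc d) - poly r (z (Suc d))) / poly w (z (Suc d))"
  have "z (Suc d) \<noteq> z i" if "i \<le> d" for i
    using inj_onD[OF Suc.prems, of "Suc d" i] that by auto
  then have w0: "poly w (z (Suc d)) \<noteq> 0"
    by (auto simp: w_def poly_prod)
  have w1: "poly w (z j) = 0" if "j \<le> d" for j
    using that by (auto simp: w_def poly_prod)
  have "degree w \<le> (\<Sum>i\<le>d. degree [:- z i, 1:])"
    unfolding w_def by (rule degree_prod_sum_le[unfolded o_def]) simp
  then have "degree w \<le> Suc d" by simp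
  then have "degree (r + smult c w) \<le> Suc d"
    using r(1) by (intro degree_add_le order_trans[OF degree_smult_le]) auto
  moreover have "poly (r + smult c w) (z j) = v j" if "j \<le> Suc d" for j
    using that r(2) w0 w1 by (cases "j = Suc d") (auto simp: c_def)
  ultimately show ?case by blast
qed

definition gram_proj_left :: "nat \<Rightarrow> nat \<Rightarrow> (real \<Rightarrow> real) \<Rightarrow> real poly" where
  "gram_proj_left d n f = (\<Sum>l<d. smult (ip_left d n f (poly (gram_left d n l))) (gram_left d n l))"

definition gram_proj_right :: "nat \<Rightarrow> nat \<Rightarrow> (real \<Rightarrow> real) \<Rightarrow> real poly" where
  "gram_proj_right d n f = (\<Sum>l<d. smult (ip_right d n f (poly (gram_right d n l))) (gram_right d n l))"

text \<open>The form sees f only at d nodes, so f may be exchanged for its interpolant of degree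
  below d, and the projection reproduces that interpolant.\<close>

lemma gram_proj_left_interpolates:
  assumes n: "n > 0" and d: "d \<ge> 1"
  shows "degree (gram_proj_left d n f) < d"
    and "\<And>j. j < d \<Longrightarrow> poly (gram_proj_left d n f) (grid_pt n j) = f (grid_pt n j)"
proof -
  obtain r where r: "degree r \<le> d - 1" "\<forall>j\<le>d - 1. poly r (grid_pt n j) = f (grid_pt n j)"
    using interpolating_poly_exists[OF inj_grid_pt[OF n], of "d - 1" "\<lambda>j. f (grid_pt n j)"] by blast
  have "ip_left d n f (poly (gram_left d n l)) = ip_left d n (poly r) (poly (gram_left d n l))" for l
    unfolding ip_left_def using r(2) by (intro sum.cong) auto
  then have eq: "gram_proj_left d n f = r"
    using gram_left_reproduces[OF n, of r d] r(1) d by (simp add: gram_proj_left_def)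
  show "degree (gram_proj_left d n f) < d" using r d by (simp add: eq)
  show "\<And>j. j < d \<Longrightarrow> poly (gram_proj_left d n f) (grid_pt n j) = f (grid_pt n j)"
    using r d by (auto simp: eq)
qed

text \<open>Translation by \<open>1 - (d - 1) / n\<close> carries the node of index d - 1 - j to the
  one of index n - j, so the right form is the left one with the order of summation reversed. The
  bound \<open>n \<ge> d - 1\<close> keeps the subtraction n - j exact.\<close>

lemma gram_proj_right_eq:
  assumes n: "n > 0" and d: "d \<ge> 1" "n \<ge> d - 1"
  shows "gram_proj_right d n f =
    pcompose (gram_proj_left d n (\<lambda>y. f (y + 1 - (real d - 1) / real n))) [:- 1 +
      (real d - 1) / real n, 1:]"
proof -
  have "ip_right d n f (poly (gram_right d n l)) =
      ip_left d n (\<lambda>y. f (y + 1 - (real d - 1) / real n)) (poly (gram_left d n l))" for l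
  proof -
    have "ip_right d n f (poly (gram_right d n l)) =
      (\<Sum>j<d. (\<lambda>i. f (grid_pt n i +
        1 - (real d - 1) / real n) * poly (gram_left d n l) (grid_pt n i)) (d - Suc j))"
      unfolding ip_right_def
    proof (intro sum.cong refl)
      fix j assume j: "j \<in> {..<d}"
      have e1: "grid_pt n (d - Suc j) + 1 - (real d - 1) / real n = grid_pt n (n - j)"
        using j d n by (simp add: grid_pt_def of_nat_diff field_simps)
      have e2: "(real d - 1) / real n - 1 + grid_pt n (n - j) = grid_pt n (d - Suc j)"
        using j d n by (simp add: grid_pt_def of_nat_diff field_simps)
      show "f (grid_pt n (n - j)) * poly (gram_right d n l) (grid_pt n (n - j)) =
        (\<lambda>i. f (grid_pt n i +
          1 - (real d - 1) / real n) * poly (gram_left d n l) (grid_pt n i)) (d - Suc j)"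
        unfolding e1 by (simp add: gram_right_def poly_pcompose e2)
    qed
    also have "\<dots> = ip_left d n (\<lambda>y. f (y + 1 - (real d - 1) / real n)) (poly (gram_left d n l))"
      unfolding ip_left_def by (rule sum.nat_diff_reindex)
    finally show ?thesis .
  qed
  then show ?thesis
    unfolding gram_proj_right_def gram_proj_left_def pcompose_sum pcompose_smult gram_right_def by simp
qed

lemma gram_proj_right_interpolates:
  assumes n: "n > 0" and d: "d \<ge> 1" "n \<ge> d - 1"
  shows "degree (gram_proj_right d n f) < d"
    and "\<And>j. j < d \<Longrightarrow> poly (gram_proj_right d n f) (grid_pt n (n - j)) = f (grid_pt n (n - j))"
proof -
  show "degree (gram_proj_right d n f) < d"
    unfolding gram_proj_right_eq[OF assms] degree_pcompose
    using gram_proj_left_interpolates(1)[OF n d(1)] by simp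
  fix j assume j: "j < d"
  have e1: "grid_pt n (d - Suc j) + 1 - (real d - 1) / real n = grid_pt n (n - j)"
    using j d n by (simp add: grid_pt_def of_nat_diff field_simps)
  have e2: "(real d - 1) / real n - 1 + grid_pt n (n - j) = grid_pt n (d - Suc j)"
    using j d n by (simp add: grid_pt_def of_nat_diff field_simps)
  show "poly (gram_proj_right d n f) (grid_pt n (n - j)) = f (grid_pt n (n - j))"
    unfolding gram_proj_right_eq[OF assms] using j e1
    by (simp add: poly_pcompose e2 gram_proj_left_interpolates(2)[OF n d(1)])
qed

lemma higher_pderiv_eq_0: "degree p < m \<Longrightarrow> (pderiv ^^ m) p = (0 :: real poly)"
proof (induction m arbitrary: p)
  case (Suc m)
  have "(pderiv ^^ m) (pderiv p) = 0"
  proof (cases "m = 0")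
    case True
    then show ?thesis using Suc.prems by (simp add: pderiv_eq_0_iff)
  next
    case False
    then show ?thesis using Suc.prems by (intro Suc.IH) (simp add: degree_pderiv)
  qed
  then show ?case by (simp add: funpow_Suc_right del: funpow.simps)
qed simp

lemma degree_gram_right: "degree (gram_right d n l) \<le> l"
  using degree_gram_left[of d n l] by (simp add: gram_right_def degree_pcompose)

text \<open>The l-th Gram polynomials have degree at most l, so their derivatives of higher order
  vanish and each inner sum may run up to d - 1. After exchanging the sums the extension depends on
  f only through the two interpolants.\<close>

lemma gram_extension_eq:
  "gram_extension d b n f x =
    (\<Sum>m<d. poly ((pderiv ^^ m) (gram_proj_left d n f)) 0 * hermite2 (d - 1) m b 1 x) +
    (\<Sum>m<d. poly ((pderiv ^^ m) (gram_proj_right d n f)) 1 * hermite2 (d - 1) m 1 b x)"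
proof -
  have *: "(\<Sum>l<d. c l * (\<Sum>m=0..l. poly ((pderiv ^^ m) (g l)) a * h m)) =
      (\<Sum>m<d. poly ((pderiv ^^ m) (\<Sum>l<d. smult (c l) (g l))) a * h m)"
    if "\<And>l. degree (g l) \<le> l" for c h :: "nat \<Rightarrow> real" and g :: "nat \<Rightarrow> real poly" and a
  proof -
    have "(\<Sum>m=0..l. poly ((pderiv ^^ m) (g l)) a * h m) =
      (\<Sum>m<d. poly ((pderiv ^^ m) (g l)) a * h m)" if "l < d" for l
    proof (rule sum.mono_neutral_left)
      show "\<forall>m\<in>{..<d} - {0..l}. poly ((pderiv ^^ m) (g l)) a * h m = 0"
        using \<open>\<And>l. degree (g l) \<le> l\<close>[of l] by (auto simp: higher_pderiv_eq_0)
    qed (use that in auto)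
    then have "(\<Sum>l<d. c l * (\<Sum>m=0..l. poly ((pderiv ^^ m) (g l)) a * h m)) =
       (\<Sum>l<d. \<Sum>m<d. c l * (poly ((pderiv ^^ m) (g l)) a * h m))"
      by (simp add: sum_distrib_left)
    also have "\<dots> = (\<Sum>m<d. \<Sum>l<d. c l * (poly ((pderiv ^^ m) (g l)) a * h m))"
      by (rule sum.swap)
    also have "\<dots> = (\<Sum>m<d. poly ((pderiv ^^ m) (\<Sum>l<d. smult (c l) (g l))) a * h m)"
      by (simp add: higher_pderiv_sum higher_pderiv_smult poly_sum sum_distrib_right mult.assoc)
    finally show ?thesis .
  qed
  show ?thesis
    unfolding gram_extension_def gram_left_ext_def gram_right_ext_def gram_proj_left_def gram_proj_right_def
    by (simp add: * degree_gram_left degree_gram_right)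
qed

section \<open>Two-point Hermite polynomials\<close>

text \<open>The sum is the power series of \<open>(1 - T)^-(r+1)\<close> cut after degree s, so the
  product is 1 modulo \<open>T^(s+1)\<close>. Multiplying by 1 - T lowers r by Pascal's rule up to
  one boundary term. A general commutative ring is used so that T may be a polynomial.\<close>

lemma truncated_binomial_series:
  fixes T :: "'a :: comm_ring_1"
  shows "\<exists>Q. (1 - T) ^ (r + 1) * (\<Sum>l\<le>s. of_nat ((r + l) choose r) * T ^ l) = 1 + T ^ Suc s * Q"
proof (induction r)
  case 0
  have "(1 - T) * (\<Sum>l\<le>s. T ^ l) = 1 - T ^ Suc s"
    by (simp add: one_diff_power_eq lessThan_Suc_atMost del: power_Suc)
  then show ?case by (intro exI[of _ "-1"]) simp
next
  case (Suc r)
  then obtain Q where Q: "(1 - T) ^ (r + 1) * (\<Sum>l\<le>s. of_nat ((r + l) choose r) * T ^ l) =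
      1 + T ^ Suc s * Q"
    by blast
  have step: "(1 - T) * (\<Sum>l\<le>t. of_nat ((Suc r + l) choose Suc r) * T ^ l) =
      (\<Sum>l\<le>t. of_nat ((r + l) choose r) * T ^ l) - of_nat ((Suc r + t) choose Suc r) * T ^ Suc t" for t
  proof (induction t)
    case (Suc t)
    have "(Suc r + Suc t) choose Suc r = ((r + Suc t) choose r) + ((Suc r + t) choose Suc r)"
      using choose_reduce_nat[of "Suc r + Suc t" "Suc r"] by simp
    then have c: "of_nat ((Suc r + Suc t) choose Suc r) =
      (of_nat ((r + Suc t) choose r) + of_nat ((Suc r + t) choose Suc r) :: 'a)"
      by simp
    show ?case
      unfolding sum.atMost_Suc distrib_left[of "1 - T"] Suc.IH unfolding c by (simp add: algebra_simps)
  qed (simp add: algebra_simps)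
  have "(1 - T) ^ (Suc r + 1) * (\<Sum>l\<le>s. of_nat ((Suc r + l) choose Suc r) * T ^ l) =
    (1 - T) ^ (r + 1) * ((1 - T) * (\<Sum>l\<le>s. of_nat ((Suc r + l) choose Suc r) * T ^ l))"
    by (simp add: mult_ac)
  also have "\<dots> = 1 + T ^ Suc s * (Q - (1 - T) ^ (r + 1) * of_nat ((Suc r + s) choose Suc r))"
    unfolding step right_diff_distrib Q by (simp add: algebra_simps)
  finally show ?case by blast
qed

lemma poly_higher_pderiv_root:
  fixes Q :: "real poly"
  assumes "j < k"
  shows "poly ((pderiv ^^ j) ([:- a, 1:] ^ k * Q)) a = 0"
  using assms
proof (induction j arbitrary: k Q)
  case 0
  then show ?case by simp
next
  case (Suc j)
  then obtain k' where k: "k = Suc k'" by (cases k) auto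
  have "pderiv ([:- a, 1:] ^ k * Q) = [:- a, 1:] ^ k' * (smult (of_nat k) Q + [:- a, 1:] * pderiv Q)"
    unfolding k pderiv_mult pderiv_power_Suc by (simp add: pderiv_pCons algebra_simps)
  then show ?case using Suc k by (simp add: funpow_Suc_right del: funpow.simps)
qed

lemma poly_higher_pderiv_power:
  "poly ((pderiv ^^ j) ([:- a, 1:] ^ m)) (a :: real) = (if j = m then fact m else 0)"
proof (induction m arbitrary: j)
  case 0
  have "(pderiv ^^ Suc i) (1 :: real poly) = 0" for i
    by (induction i) simp_all
  then show ?case by (cases j) (simp_all del: funpow.simps)
next
  case (Suc m)
  show ?case
  proof (cases j)
    case (Suc i)
    have "pderiv ([:- a, 1:] ^ Suc m) = smult (of_nat (Suc m)) ([:- a, 1:] ^ m)"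
      unfolding pderiv_power_Suc by (simp add: pderiv_pCons)
    then show ?thesis
      using Suc.IH[of i] by (simp add: Suc funpow_Suc_right higher_pderiv_smult del: funpow.simps)
  qed simp
qed

definition hermite_poly :: "nat \<Rightarrow> nat \<Rightarrow> real \<Rightarrow> real \<Rightarrow> real poly" where
  "hermite_poly r m u1 u2 =
     smult (1 / fact m) ([:- u1, 1:] ^ m * (smult (1 / (u1 - u2)) [:- u2, 1:]) ^ (r + 1) *
       (\<Sum>l\<le>r - m. of_nat ((r + l) choose r) * (smult (1 / (u2 - u1)) [:- u1, 1:]) ^ l))"

lemma poly_hermite_poly: "poly (hermite_poly r m u1 u2) u = hermite2 r m u1 u2 u"
proof -
  have lin: "poly (smult (1 / a) [:- c, 1:]) u = (u - c) / a" "poly [:- c, 1:] u = u - c" for a c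
    by (simp_all add: diff_divide_distrib)
  show ?thesis
    unfolding hermite_poly_def hermite2_def atMost_atLeast0
    by (subst poly_smult) (simp only: poly_mult poly_power poly_sum lin poly_of_nat mult.assoc)
qed

text \<open>With T the affine map sending u1 to 0 and u2 to 1, the factor vanishing at u2 is 1 - T.
  The truncated series then shows that the polynomial is \<open>(u - u1)^m / m!\<close> modulo
  \<open>(u - u1)^(r+1)\<close>, while \<open>(u - u2)^(r+1)\<close> divides it. Derivatives up to
  order r do not see such multiples.\<close>

lemma hermite_poly_higher_pderiv:
  assumes "u1 \<noteq> u2" "m \<le> r" "j \<le> r"
  shows "poly ((pderiv ^^ j) (hermite_poly r m u1 u2)) u1 = (if j = m then 1 else 0)"
    and "poly ((pderiv ^^ j) (hermite_poly r m u1 u2)) u2 = 0"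
proof -
  define T where "T = smult (1 / (u2 - u1)) [:- u1, 1:]"
  define W where "W = (\<Sum>l\<le>r - m. of_nat ((r + l) choose r) * T ^ l)"
  have T1: "smult (1 / (u1 - u2)) [:- u2, 1:] = 1 - T"
    using assms(1) by (simp add: T_def one_pCons field_simps)
  have H: "hermite_poly r m u1 u2 = smult (1 / fact m) ([:- u1, 1:] ^ m * (1 - T) ^ (r + 1) * W)"
    unfolding hermite_poly_def T1 W_def T_def ..
  obtain Q where Q: "(1 - T) ^ (r + 1) * W = 1 + T ^ Suc (r - m) * Q"
    unfolding W_def using truncated_binomial_series by blast
  have "[:- u1, 1:] ^ m * T ^ Suc (r - m) =
      smult ((1 / (u2 - u1)) ^ Suc (r - m)) ([:- u1, 1:] ^ (m + Suc (r - m)))"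
    by (simp only: T_def smult_power mult_smult_right power_add)
  also have "m + Suc (r - m) = Suc r" using assms by simp
  finally have "[:- u1, 1:] ^ m * (1 - T) ^ (r + 1) * W =
      [:- u1, 1:] ^ m + [:- u1, 1:] ^ Suc r * smult ((1 / (u2 - u1)) ^ Suc (r - m)) Q"
    unfolding mult.assoc Q by (simp only: distrib_left mult_1_right mult.assoc[symmetric]) simp
  then have "poly ((pderiv ^^ j) (hermite_poly r m u1 u2)) u1 =
      (1 / fact m) * (poly ((pderiv ^^ j) ([:- u1, 1:] ^ m)) u1 +
     poly ((pderiv ^^ j) ([:- u1, 1:] ^ Suc r * smult ((1 / (u2 - u1)) ^ Suc (r - m)) Q)) u1)"
    unfolding H by (simp only: higher_pderiv_smult higher_pderiv_add poly_smult poly_add)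
  also have "\<dots> = (if j = m then 1 else 0)"
    using assms by (subst poly_higher_pderiv_root) (auto simp: poly_higher_pderiv_power)
  finally show "poly ((pderiv ^^ j) (hermite_poly r m u1 u2)) u1 = (if j = m then 1 else 0)" .
  have "hermite_poly r m u1 u2 =
      [:- u2, 1:] ^ Suc r * smult (1 / fact m * (1 / (u1 - u2)) ^ Suc r) ([:- u1, 1:] ^ m * W)"
    unfolding H T1[symmetric] smult_power by (simp add: mult_ac)
  then show "poly ((pderiv ^^ j) (hermite_poly r m u1 u2)) u2 = 0"
    using assms by (metis poly_higher_pderiv_root le_imp_less_Suc)
qed

section \<open>The extended function\<close>

definition extension_poly :: "nat \<Rightarrow> real \<Rightarrow> nat \<Rightarrow> (real \<Rightarrow> real) \<Rightarrow> real poly" where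
  "extension_poly d b n f =
    (\<Sum>m<d. smult (poly ((pderiv ^^ m) (gram_proj_left d n f)) 0) (hermite_poly (d - 1) m b 1)) +
    (\<Sum>m<d. smult (poly ((pderiv ^^ m) (gram_proj_right d n f)) 1) (hermite_poly (d - 1) m 1 b))"

lemma poly_extension_poly: "poly (extension_poly d b n f) x = gram_extension d b n f x"
  by (simp add: extension_poly_def gram_extension_eq poly_sum poly_hermite_poly)

lemma poly_higher_pderiv_extension:
  "poly ((pderiv ^^ j) (extension_poly d b n f)) x =
    (\<Sum>m<d. poly ((pderiv ^^ m) (gram_proj_left d n f)) 0 * poly ((pderiv ^^ j) (hermite_poly (d - 1) m b 1)) x) +
    (\<Sum>m<d. poly ((pderiv ^^ m) (gram_proj_right d n f)) 1 * poly ((pderiv ^^ j) (hermite_poly (d - 1) m 1 b)) x)"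
  by (simp add: extension_poly_def higher_pderiv_add higher_pderiv_sum higher_pderiv_smult poly_sum)

lemma extension_poly_endpoint_derivs:
  assumes "b > 1" "j < d"
  shows "poly ((pderiv ^^ j) (extension_poly d b n f)) 1 =
      poly ((pderiv ^^ j) (gram_proj_right d n f)) 1"
    and "poly ((pderiv ^^ j) (extension_poly d b n f)) b =
      poly ((pderiv ^^ j) (gram_proj_left d n f)) 0"
proof -
  have H: "poly ((pderiv ^^ j) (hermite_poly (d - Suc 0) m u1 u2)) u1 = (if j = m then 1 else 0)"
    "poly ((pderiv ^^ j) (hermite_poly (d - Suc 0) m u1 u2)) u2 = 0" if "m < d" "u1 \<noteq> u2" for m u1 u2
    using hermite_poly_higher_pderiv[of u1 u2 m "d - Suc 0" j] that assms by auto
  show "poly ((pderiv ^^ j) (extension_poly d b n f)) 1 =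
      poly ((pderiv ^^ j) (gram_proj_right d n f)) 1"
  proof -
    have "(\<Sum>m<d. poly ((pderiv ^^ m) (gram_proj_right d n f)) 1 * poly ((pderiv ^^ j) (hermite_poly (d - 1) m 1 b)) 1) =
       (\<Sum>m<d. if m = j then poly ((pderiv ^^ m) (gram_proj_right d n f)) 1 else 0)"
      using assms by (intro sum.cong) (auto simp: H)
    moreover have "(\<Sum>m<d. poly ((pderiv ^^ m) (gram_proj_left d n f)) 0 * poly ((pderiv ^^ j) (hermite_poly (d - 1) m b 1)) 1) = 0"
      using assms by (intro sum.neutral) (auto simp: H)
    ultimately show ?thesis using assms by (simp add: poly_higher_pderiv_extension)
  qed
  show "poly ((pderiv ^^ j) (extension_poly d b n f)) b = poly ((pderiv ^^ j) (gram_proj_left d n f)) 0"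
  proof -
    have "(\<Sum>m<d. poly ((pderiv ^^ m) (gram_proj_left d n f)) 0 * poly ((pderiv ^^ j) (hermite_poly (d - 1) m b 1)) b) =
       (\<Sum>m<d. if m = j then poly ((pderiv ^^ m) (gram_proj_left d n f)) 0 else 0)"
      using assms by (intro sum.cong) (auto simp: H)
    moreover have "(\<Sum>m<d. poly ((pderiv ^^ m) (gram_proj_right d n f)) 1 * poly ((pderiv ^^ j) (hermite_poly (d - 1) m 1 b)) b) = 0"
      using assms by (intro sum.neutral) (auto simp: H)
    ultimately show ?thesis using assms by (simp add: poly_higher_pderiv_extension)
  qed
qed

text \<open>Because the degree of P is below d, the d-th derivative of the error is
  \<open>D d\<close> alone, so M is free of P and of the nodes.\<close>

lemma interpolant_derivs_close:
  fixes D :: "nat \<Rightarrow> real \<Rightarrow> real" and P :: "real poly"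
  assumes D: "\<And>m y. y \<in> {\<alpha>..\<beta>} \<Longrightarrow> (D m has_real_derivative D (Suc m) y) (at y within {\<alpha>..\<beta>})"
    and z: "strict_mono_on {..<d} z" "\<And>i. i < d \<Longrightarrow> z i \<in> {\<alpha>..\<beta>}" "\<And>i. i < d \<Longrightarrow> poly P (z i) = D 0 (z i)"
    and P: "degree P < d" and M: "\<And>y. y \<in> {\<alpha>..\<beta>} \<Longrightarrow> \<bar>D d y\<bar> \<le> M"
    and "m \<le> d" "x \<in> {\<alpha>..\<beta>}"
  shows "\<bar>D m x - poly ((pderiv ^^ m) P) x\<bar> \<le> M * (\<beta> - \<alpha>) ^ (d - m)"
proof -
  have "((\<lambda>y. D m y - poly ((pderiv ^^ m) P) y) has_real_derivative
      D (Suc m) y - poly ((pderiv ^^ Suc m) P) y) (at y within {\<alpha>..\<beta>})" if "y \<in> {\<alpha>..\<beta>}" for m y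
    using D[OF that] by (auto intro!: derivative_eq_intros poly_DERIV[THEN DERIV_subset])
  then show ?thesis
    using derivative_bound_of_zeros[where g =
      "\<lambda>m y. D m y - poly ((pderiv ^^ m) P) y", of \<alpha> \<beta> d z M m x]
      assms by (simp add: higher_pderiv_eq_0)
qed

text \<open>The nodes at each end fill an interval of length L with endpoint 0 or 1. By
  \<open>n \<ge> d - 1\<close> it lies in [0,1], where f is controlled. For d = 1 it shrinks to a
  point, and the bound reads 0 for m = 0 and M for m = 1.\<close>

lemma smooth_piece_bounds:
  assumes n: "n > 0" and d: "d \<ge> 1" "n \<ge> d - 1"
    and D: "\<And>m y. y \<in> {0..1} \<Longrightarrow> (D m has_real_derivative D (Suc m) y) (at y within {0..1})"
    and f: "\<And>y. y \<in> {0..1} \<Longrightarrow> f y = D 0 y"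
    and M: "\<And>y. y \<in> {0..1} \<Longrightarrow> \<bar>D d y\<bar> \<le> M"
    and m: "m \<le> d"
  shows "\<bar>D m 0 - poly ((pderiv ^^ m) (gram_proj_left d n f)) 0\<bar> \<le>
      M * ((real d - 1) / real n) ^ (d - m)"
    and "\<bar>D m 1 - poly ((pderiv ^^ m) (gram_proj_right d n f)) 1\<bar> \<le>
      M * ((real d - 1) / real n) ^ (d - m)"
proof -
  define L where "L = (real d - 1) / real n"
  have "real d - 1 \<le> real n" using d by linarith
  then have L: "L \<le> 1" "L \<ge> 0" using n d by (auto simp: L_def divide_le_eq)
  have "\<bar>D m 0 - poly ((pderiv ^^ m) (gram_proj_left d n f)) 0\<bar> \<le> M * (L - 0) ^ (d - m)"
  proof (rule interpolant_derivs_close[where z = "grid_pt n"])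
    show "(D m has_real_derivative D (Suc m) y) (at y within {0..L})" if "y \<in> {0..L}" for m y
      using D[of y m] that L by (auto intro: DERIV_subset)
    show "strict_mono_on {..<d} (grid_pt n)"
      using n by (auto simp: strict_mono_on_def grid_pt_def divide_strict_right_mono)
    show z: "grid_pt n i \<in> {0..L}" if "i < d" for i
      using n that by (auto simp: grid_pt_def L_def intro!: divide_right_mono)
    show "poly (gram_proj_left d n f) (grid_pt n i) = D 0 (grid_pt n i)" if "i < d" for i
      using gram_proj_left_interpolates(2)[OF n d(1) that] f z[OF that] L by auto
    show "degree (gram_proj_left d n f) < d"
      by (rule gram_proj_left_interpolates(1)[OF n d(1)])
  qed (use M m L in auto)
  then show "\<bar>D m 0 - poly ((pderiv ^^ m) (gram_proj_left d n f)) 0\<bar> \<le>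
      M * ((real d - 1) / real n) ^ (d - m)"
    by (simp add: L_def)
  \<comment> \<open>The right-hand nodes are enumerated as n - (d - 1 - i), so that they increase
    with i.\<close>
  have "\<bar>D m 1 - poly ((pderiv ^^ m) (gram_proj_right d n f)) 1\<bar> \<le> M * (1 - (1 - L)) ^ (d - m)"
  proof (rule interpolant_derivs_close[where z = "\<lambda>i. grid_pt n (n - (d - Suc i))"])
    show "(D m has_real_derivative D (Suc m) y) (at y within {1 - L..1})" if "y \<in> {1 - L..1}" for m y
      using D[of y m] that L by (auto intro: DERIV_subset)
    show "strict_mono_on {..<d} (\<lambda>i. grid_pt n (n - (d - Suc i)))"
      using n d by (auto simp: strict_mono_on_def grid_pt_def intro!: divide_strict_right_mono)
    show z: "grid_pt n (n - (d - Suc i)) \<in> {1 - L..1}" if "i < d" for i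
      using n d that by (auto simp: grid_pt_def L_def of_nat_diff field_simps)
    show "poly (gram_proj_right d n f) (grid_pt n (n - (d - Suc i))) =
      D 0 (grid_pt n (n - (d - Suc i)))" if "i < d" for i
      using gram_proj_right_interpolates(2)[OF n d, of "d - Suc i" f] f z[OF that] L that by auto
    show "degree (gram_proj_right d n f) < d"
      by (rule gram_proj_right_interpolates(1)[OF n d])
  qed (use M m L in auto)
  then show "\<bar>D m 1 - poly ((pderiv ^^ m) (gram_proj_right d n f)) 1\<bar> \<le>
      M * ((real d - 1) / real n) ^ (d - m)"
    by (simp add: L_def)
qed

section \<open>Bounds uniform in n and the final estimate\<close>

lemma continuous_bounded_Icc:
  fixes g :: "real \<Rightarrow> real"
  assumes "continuous_on {\<alpha>..\<beta>} g"
  obtains B where "B \<ge> 0" "\<And>y. y \<in> {\<alpha>..\<beta>} \<Longrightarrow> \<bar>g y\<bar> \<le> B"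
proof -
  have "bounded (g ` {\<alpha>..\<beta>})"
    using assms by (intro compact_imp_bounded compact_continuous_image) auto
  then obtain B where "\<forall>x\<in>g ` {\<alpha>..\<beta>}. norm x \<le> B" by (auto simp: bounded_iff)
  then show ?thesis by (intro that[of "max 0 B"]) (auto simp: max.coboundedI2)
qed

lemma uniform_bound_finite_family:
  fixes g :: "'i \<Rightarrow> real \<Rightarrow> real"
  assumes "finite I" "\<And>i. i \<in> I \<Longrightarrow> continuous_on {\<alpha>..\<beta>} (g i)"
  obtains B where "B \<ge> 0" "\<And>i y. i \<in> I \<Longrightarrow> y \<in> {\<alpha>..\<beta>} \<Longrightarrow> \<bar>g i y\<bar> \<le> B"
proof -
  have "\<exists>B\<ge>0. \<forall>y\<in>{\<alpha>..\<beta>}. \<bar>g i y\<bar> \<le> B" if "i \<in> I" for i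
    using continuous_bounded_Icc[OF assms(2)[OF that]] by metis
  then obtain B where B: "\<And>i. i \<in> I \<Longrightarrow> B i \<ge> 0" "\<And>i y. i \<in> I \<Longrightarrow> y \<in> {\<alpha>..\<beta>} \<Longrightarrow> \<bar>g i y\<bar> \<le> B i"
    by metis
  show ?thesis
  proof
    show "sum B I \<ge> 0" using B by (intro sum_nonneg) auto
    show "\<bar>g i y\<bar> \<le> sum B I" if "i \<in> I" "y \<in> {\<alpha>..\<beta>}" for i y
      using B(2)[OF that] member_le_sum[of i I B] B(1) that assms(1) by fastforce
  qed
qed

text \<open>C must be chosen before n. Only the coefficients of the extension vary with n, and they
  are at most 2 M: the interpolants deviate from f at the endpoints by at most M in each derivative
  up to order d.\<close>

lemma extension_derivs_uniformly_close:
  assumes d: "d \<ge> 1" and b: "b > 1"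
    and D: "\<And>m y. y \<in> {0..1} \<Longrightarrow> (D m has_real_derivative D (Suc m) y) (at y within {0..1})"
    and f: "\<And>y. y \<in> {0..1} \<Longrightarrow> f y = D 0 y"
  obtains C where "C \<ge> 0"
    "\<And>n m. n > 0 \<Longrightarrow> n \<ge> d - 1 \<Longrightarrow> m \<le> d \<Longrightarrow>
       \<bar>poly ((pderiv ^^ m) (extension_poly d b n f)) 1 - D m 1\<bar> \<le> C * (1 / real n) ^ (d - m)"
    "\<And>n m. n > 0 \<Longrightarrow> n \<ge> d - 1 \<Longrightarrow> m \<le> d \<Longrightarrow>
       \<bar>D m 0 - poly ((pderiv ^^ m) (extension_poly d b n f)) b\<bar> \<le> C * (1 / real n) ^ (d - m)"
    "\<And>y. y \<in> {0..1} \<Longrightarrow> \<bar>D (Suc d) y\<bar> \<le> C"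
    "\<And>n y. n > 0 \<Longrightarrow> n \<ge> d - 1 \<Longrightarrow> y \<in> {1..b} \<Longrightarrow> \<bar>poly ((pderiv ^^ Suc d) (extension_poly d b n f)) y\<bar> \<le> C"
proof -
  obtain M where M: "M \<ge> 0" "\<And>m y. m \<in> {..Suc d} \<Longrightarrow> y \<in> {0..1} \<Longrightarrow> \<bar>D m y\<bar> \<le> M"
    using uniform_bound_finite_family[of "{..Suc d}" 0 1 D] DERIV_continuous_on[OF D] by blast
  \<comment> \<open>One finite family free of n: j is the order of differentiation, and e tells
    whether the data are prescribed at b or at 1.\<close>
  define h where "h =
      (\<lambda>(j, m, e). poly ((pderiv ^^ j) (if e then hermite_poly (d - 1) m b 1 else hermite_poly (d - 1) m 1 b)))"
  obtain H where H: "H \<ge> 0" "\<And>i y. i \<in> {d, Suc d} \<times> {..<d} \<times> UNIV \<Longrightarrow> y \<in> {1..b} \<Longrightarrow> \<bar>h i y\<bar> \<le> H"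
  proof (rule uniform_bound_finite_family[of "{d, Suc d} \<times> {..<d} \<times> UNIV" 1 b h])
    show "continuous_on {1..b} (h i)" for i
      by (cases i) (auto simp: h_def intro!: poly_isCont continuous_at_imp_continuous_on)
  qed auto
  \<comment> \<open>The first term absorbs \<open>(d - 1)^k \<le> d^d\<close> for orders below d.
    The last one bounds derivatives of the extension, a sum of 2 d products of size at most 2 M H;
    the middle M accounts for f itself.\<close>
  define C where "C = M * real d ^ d + M + 4 * real d * M * H"
  have C: "M * real d ^ d \<le> C" "M \<le> C" "M + 4 * real d * M * H \<le> C" "4 * real d * M * H \<le> C" "C \<ge> 0"
    using M(1) H(1) by (auto simp: C_def)
  have ratio: "((real d - 1) / real n) ^ k \<le> real d ^ d * (1 / real n) ^ k" if "k \<le> d" for n k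
  proof -
    have "(real d - 1) ^ k \<le> real d ^ k" using d by (intro power_mono) auto
    also have "\<dots> \<le> real d ^ d" using d that by (intro power_increasing) auto
    finally have "(real d - 1) ^ k * (1 / real n) ^ k \<le> real d ^ d * (1 / real n) ^ k"
      by (intro mult_right_mono) auto
    then show ?thesis by (simp add: power_divide)
  qed
  have proj: "\<bar>D m 0 - poly ((pderiv ^^ m) (gram_proj_left d n f)) 0\<bar> \<le> C * (1 / real n) ^ (d - m)"
    "\<bar>D m 1 - poly ((pderiv ^^ m) (gram_proj_right d n f)) 1\<bar> \<le> C * (1 / real n) ^ (d - m)"
    "\<bar>poly ((pderiv ^^ m) (gram_proj_left d n f)) 0\<bar> \<le> 2 * M"
    "\<bar>poly ((pderiv ^^ m) (gram_proj_right d n f)) 1\<bar> \<le> 2 * M"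
    if n: "n > 0" "n \<ge> d - 1" and m: "m \<le> d" for n m
  proof -
    note S = smooth_piece_bounds[where D=D, OF n(1) d n(2) D f M(2) m]
    have 1: "M * ((real d - 1) / real n) ^ (d - m) \<le> C * (1 / real n) ^ (d - m)"
    proof -
      have "M * ((real d - 1) / real n) ^ (d - m) \<le> M * (real d ^ d * (1 / real n) ^ (d - m))"
        using M(1) ratio by (intro mult_left_mono) auto
      also have "\<dots> = (M * real d ^ d) * (1 / real n) ^ (d - m)" by simp
      also have "\<dots> \<le> C * (1 / real n) ^ (d - m)" using C(1) by (intro mult_right_mono) auto
      finally show ?thesis .
    qed
    have "real d - 1 \<le> real n" using n d by linarith
    then have "((real d - 1) / real n) ^ (d - m) \<le> 1"
      using n d by (intro power_le_one) (auto simp: divide_le_eq)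
    then have 2: "M * ((real d - 1) / real n) ^ (d - m) \<le> M"
      using M(1) by (simp add: mult_left_le)
    show "\<bar>D m 0 - poly ((pderiv ^^ m) (gram_proj_left d n f)) 0\<bar> \<le> C * (1 / real n) ^ (d - m)"
      "\<bar>D m 1 - poly ((pderiv ^^ m) (gram_proj_right d n f)) 1\<bar> \<le> C * (1 / real n) ^ (d - m)"
      using S 1 by auto
    have "\<bar>D m 0\<bar> \<le> M" "\<bar>D m 1\<bar> \<le> M" using m by (auto intro!: M(2))
    then show "\<bar>poly ((pderiv ^^ m) (gram_proj_left d n f)) 0\<bar> \<le> 2 * M"
      "\<bar>poly ((pderiv ^^ m) (gram_proj_right d n f)) 1\<bar> \<le> 2 * M"
      using S 2 by auto
  qed
  have high: "\<bar>poly ((pderiv ^^ j) (extension_poly d b n f)) y\<bar> \<le> 4 * real d * M * H"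
    if n: "n > 0" "n \<ge> d - 1" and j: "j \<in> {d, Suc d}" and y: "y \<in> {1..b}" for n j y
  proof -
    have bound: "norm (c * h (j, m, e) y) \<le> 2 * M * H" if "\<bar>c\<bar> \<le> 2 * M" "m < d" for c m e
      unfolding real_norm_def abs_mult
      by (rule mult_mono[OF that(1)]) (use that j y M(1) in \<open>auto intro!: H(2)\<close>)
    have "\<bar>\<Sum>m<d. poly ((pderiv ^^ m) (gram_proj_left d n f)) 0 * h (j, m, True) y\<bar> \<le> (\<Sum>m<d. 2 * M * H)"
      unfolding real_norm_def[symmetric]
      by (rule sum_norm_le, rule bound) (use n in \<open>auto intro!: proj\<close>)
    moreover have "\<bar>\<Sum>m<d. poly ((pderiv ^^ m) (gram_proj_right d n f)) 1 * h (j, m, False) y\<bar> \<le>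
      (\<Sum>m<d. 2 * M * H)"
      unfolding real_norm_def[symmetric]
      by (rule sum_norm_le, rule bound) (use n in \<open>auto intro!: proj\<close>)
    moreover have "poly ((pderiv ^^ j) (extension_poly d b n f)) y =
        (\<Sum>m<d. poly ((pderiv ^^ m) (gram_proj_left d n f)) 0 * h (j, m, True) y) +
        (\<Sum>m<d. poly ((pderiv ^^ m) (gram_proj_right d n f)) 1 * h (j, m, False) y)"
      by (simp add: poly_higher_pderiv_extension h_def)
    ultimately show ?thesis by simp
  qed
  show ?thesis
  proof
    show "C \<ge> 0" by fact
    fix n m assume n: "n > 0" "n \<ge> d - 1" and m: "m \<le> d"
    show "\<bar>poly ((pderiv ^^ m) (extension_poly d b n f)) 1 - D m 1\<bar> \<le> C * (1 / real n) ^ (d - m)"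
    proof (cases "m = d")
      \<comment> \<open>Hermite matching stops below order d. At order d the power of 1 / n is 1, so
        the crude bounds on both sides suffice.\<close>
      case True
      then show ?thesis
        using high[OF n, of d 1] M(2)[of d 1] C(3) b by simp
    next
      case False
      then show ?thesis
        using proj(2)[OF n m] extension_poly_endpoint_derivs(1)[OF b] m by (simp add: abs_minus_commute)
    qed
    show "\<bar>D m 0 - poly ((pderiv ^^ m) (extension_poly d b n f)) b\<bar> \<le> C * (1 / real n) ^ (d - m)"
    proof (cases "m = d")
      case True
      then show ?thesis
        using high[OF n, of d b] M(2)[of d 0] C(3) b by simp
    next
      case False
      then show ?thesis
        using proj(1)[OF n m] extension_poly_endpoint_derivs(2)[OF b] m by simp
    qed
  next
    show "\<bar>D (Suc d) y\<bar> \<le> C" if "y \<in> {0..1}" for y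
      using M(2)[of "Suc d" y] that C(2) by simp
    show "\<bar>poly ((pderiv ^^ Suc d) (extension_poly d b n f)) y\<bar> \<le> C"
      if "n > 0" "n \<ge> d - 1" "y \<in> {1..b}" for n y
      using high[OF that(1,2) _ that(3), of "Suc d"] C(4) by (simp del: funpow.simps)
  qed
qed

theorem theorem3p1:
  fixes d :: nat and b :: real and f :: "real \<Rightarrow> real"
  assumes "d \<ge> 1"
    and "smooth_on {0..1} f"
    and "b \<in> \<rat>" and "b > 1"
  shows "\<exists>M>0. \<forall>n\<in>Nb b. n \<ge> d - 1 \<longrightarrow>
           sup_norm_on {0..1} (\<lambda>x. fc_gram d b n f x - f x) \<le> ereal (M * real n powi (- int d))"
proof -
  note d = assms(1) and b = assms(4)
  obtain D where f: "\<And>y. y \<in> {0..1} \<Longrightarrow> f y = D 0 y"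
    and D: "\<And>m y. y \<in> {0..1} \<Longrightarrow> (D m has_real_derivative D (Suc m) y) (at y within {0..1})"
    using assms(2) unfolding smooth_on_def by metis
  obtain C where C: "C \<ge> 0"
    "\<And>n m. n > 0 \<Longrightarrow> n \<ge> d - 1 \<Longrightarrow> m \<le> d \<Longrightarrow>
       \<bar>poly ((pderiv ^^ m) (extension_poly d b n f)) 1 - D m 1\<bar> \<le> C * (1 / real n) ^ (d - m)"
    "\<And>n m. n > 0 \<Longrightarrow> n \<ge> d - 1 \<Longrightarrow> m \<le> d \<Longrightarrow>
       \<bar>D m 0 - poly ((pderiv ^^ m) (extension_poly d b n f)) b\<bar> \<le> C * (1 / real n) ^ (d - m)"
    "\<And>y. y \<in> {0..1} \<Longrightarrow> \<bar>D (Suc d) y\<bar> \<le> C"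
    "\<And>n y. n > 0 \<Longrightarrow> n \<ge> d - 1 \<Longrightarrow> y \<in> {1..b} \<Longrightarrow> \<bar>poly ((pderiv ^^ Suc d) (extension_poly d b n f)) y\<bar> \<le> C"
    using extension_derivs_uniformly_close[OF d b D f] by blast
  \<comment> \<open>The summand 1 makes M positive even when C = 0.\<close>
  define M where "M = 16 * (2 * real d + b) * C + 1"
  have Mpos: "M > 0" using C(1) b by (simp add: M_def add_nonneg_pos)
  have main: "\<bar>fc_gram d b n f x - f x\<bar> \<le> M * (1 / real n) ^ d"
    if nb: "n \<in> Nb b" and nd: "n \<ge> d - 1" and x: "x \<in> {0..1}" for n x
  proof -
    have n: "n > 0" using nb by (simp add: Nb_def)
    from nb obtain m :: nat where "real n * b = real m" "2 dvd m" by (auto simp: Nb_def)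
    then obtain K where K: "real n * b = 2 * real K" by (auto elim: dvdE)
    have "real n * b > 0" using n b by simp
    then have Kpos: "K > 0" using K by simp
    have pp: "period_pts b n = 2 * K"
      unfolding period_pts_def K by (metis floor_of_nat nat_int of_nat_mult of_nat_numeral)
    define P where "P j = poly ((pderiv ^^ j) (extension_poly d b n f))" for j
    have P: "(P j has_real_derivative P (Suc j) y) (at y within {1..b})" for j y
      by (simp add: P_def poly_DERIV has_field_derivative_at_within)
    define F where "F y = (if y \<le> 1 then D 0 y else P 0 y)" for y
    have e1: "P 0 1 = D 0 1" and e0: "P 0 b = D 0 0"
    proof -
      have "P 0 1 = poly (gram_proj_right d n f) (grid_pt n (n - 0))"
        using extension_poly_endpoint_derivs(1)[OF b, of 0 d n f] d n by (simp add: P_def grid_pt_def)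
      also have "\<dots> = f (grid_pt n (n - 0))"
        using d by (intro gram_proj_right_interpolates(2) n nd) auto
      finally show "P 0 1 = D 0 1" using n f[of 1] by (simp add: grid_pt_def)
      have "P 0 b = poly (gram_proj_left d n f) (grid_pt n 0)"
        using extension_poly_endpoint_derivs(2)[OF b, of 0 d n f] d by (simp add: P_def grid_pt_def)
      also have "\<dots> = f (grid_pt n 0)"
        using d by (intro gram_proj_left_interpolates(2) n) auto
      finally show "P 0 b = D 0 0" using f[of 0] by (simp add: grid_pt_def)
    qed
    have F1: "F y = D 0 y" if "y \<in> {0..1}" for y using that by (simp add: F_def)
    have F2: "F y = P 0 y" if "y \<in> {1..b}" for y using that e1 by (auto simp: F_def)
    have per: "F 0 = F b" using b e0 by (simp add: F_def)
    have contF: "continuous_on {0..b} F"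
    proof -
      have "continuous_on {0..1} F"
        by (rule continuous_on_eq[OF DERIV_continuous_on[OF D[of _ 0]]]) (simp_all add: F1)
      moreover have "continuous_on {1..b} F"
        by (rule continuous_on_eq[OF DERIV_continuous_on[OF P[of 0]]]) (simp_all add: F2)
      ultimately have "continuous_on ({0..1} \<union> {1..b}) F"
        by (intro continuous_on_closed_Un) auto
      moreover have "{0..1} \<union> {1..b} = {0..b}" using b by auto
      ultimately show ?thesis by simp
    qed
    define A where "A = (2 * real d + b) * C * b * (1 / real n) ^ (d - 1)"
    have A: "A \<ge> 0" using C(1) b by (simp add: A_def)
    have "\<bar>(\<Sum>j<2*K. F (grid_pt n j) * cardinal_fun b n j x) - F x\<bar> \<le> 8 * A / real K"
    proof (rule trig_interpolation_error[OF b n K x contF per A])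
      fix k assume "\<bar>k\<bar> \<ge> int K"
      then show "cmod (fourier_coeff b (\<lambda>y. complex_of_real (F y)) k) \<le> A / (real_of_int k)\<^sup>2"
        unfolding A_def
        by (intro fourier_coeff_bound_piecewise[where D=D and P=P and K=K] b n K d D P F1 F2 per)
           (use C n nd in \<open>auto simp: P_def simp del: funpow.simps\<close>)
    qed
    \<comment> \<open>\<open>K = n b / 2\<close> cancels the factor b in A and supplies the last
      power of 1 / n.\<close>
    also have "8 * A / real K = 16 * (2 * real d + b) * C * (1 / real n) ^ d"
    proof -
      have "real K = real n * b / 2" using K by simp
      moreover have "(1 / real n) ^ d = (1 / real n) ^ (d - 1) * (1 / real n)"
        using d power_minus_mult[of d "1 / real n"] by simp
      ultimately show ?thesis
        unfolding A_def using n b by (simp only:) (simp add: field_simps)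
    qed
    also have "\<dots> \<le> M * (1 / real n) ^ d"
      by (intro mult_right_mono) (auto simp: M_def)
    also have "(\<Sum>j<2*K. F (grid_pt n j) * cardinal_fun b n j x) = fc_gram d b n f x"
      unfolding fc_gram_def pp
    proof (intro sum.cong refl)
      fix j assume j: "j \<in> {..<2 * K}"
      have "F (grid_pt n j) = continued_value d b n f j"
      proof (cases "j \<le> n")
        case True
        then have "grid_pt n j \<in> {0..1}" using n by (simp add: grid_pt_def)
        then show ?thesis using True f by (simp add: continued_value_def F_def)
      next
        case False
        then have "grid_pt n j > 1" using n by (simp add: grid_pt_def)
        then show ?thesis using False
          by (simp add: continued_value_def F_def P_def poly_extension_poly)
      qed
      then show "F (grid_pt n j) * cardinal_fun b n j x =
        continued_value d b n f j * cardinal_fun b n j x"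
        by simp
    qed
    also have "F x = f x" using x f F1 by simp
    finally show ?thesis .
  qed
  show ?thesis
  proof (intro exI[of _ M] conjI ballI impI Mpos)
    fix n assume n: "n \<in> Nb b" "n \<ge> d - 1"
    have "real n powi (- int d) = (1 / real n) ^ d"
      by (simp add: power_int_minus power_one_over inverse_eq_divide)
    then show "sup_norm_on {0..1} (\<lambda>x. fc_gram d b n f x - f x) \<le> ereal (M * real n powi (- int d))"
      unfolding sup_norm_on_def using main[OF n] by (intro SUP_least) simp
  qed
qed

end
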